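(* Let $k$ be a field of characteristic zero and $k_0 \subset k$ a computable subfield, and let the monoid $M$ be either $\mathbb{N}^2$ or $\mathbb{Z}^2$. Then the following problem is undecidable: given a finite set $F$ of $M$-polynomials over $k_0$ (in finitely many variables), decide whether the system $F = 0$ has a solution in $k^M$.
   Context: $\mathbb{N}$ is the set of nonnegative integers; $\mathbb{N}^2$ and $\mathbb{Z}^2$ are monoids under addition. The ring $k^M$ of $M$-sequences is the ring of all maps $M\to k$ with componentwise operations and $M$-action $\sigma^m((x_\ell)_{\ell\in M})=(x_{\ell+m})_{\ell\in M}$; $k$ embeds as the constant sequences. The ring of $M$-polynomials over $k_0$ in $\mathbf{X}=(X_1,\ldots,X_n)$ is the polynomial ring $k_0[\sigma^m(\mathbf{X})\mid m\in M]$ in the indeterminates $\sigma^m(X_i)$, with $M$ acting trivially on $k_0$ and by $\sigma^{m_1}(\sigma^{m_2}(X_i))=\sigma^{m_1+m_2}(X_i)$. A solution of $F=0$ in $k^M$ is a tuple $\mathbf{x}\in(k^M)^n$ such that every $f\in F$ is sent to $0$ by the unique $k_0$-algebra morphism $k_0[\sigma^m(\mathbf{X})\mid m\in M]\to k^M$ commuting with the $M$-action and sending $X_i\mapsto x_i$. "Undecidable" means that no algorithm solves the problem. *)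

theory Defs
  imports
    Complex_Main
    "HOL-Library.Nat_Bijection"
    "HOL-Library.Product_Plus"
    "HOL-Library.Function_Algebras"
    "HOL-Library.Poly_Mapping"
begin

section \<open>Algorithms: partial recursive functions\<close>

datatype recf =
    Zero
  | Succ
  | Proj nat
  | Comp recf "recf list"
  | Prec recf recf
  | Mu recf

text \<open>
  \<open>computes p xs y\<close>: program \<open>p\<close> halts on the arguments \<open>xs\<close> with output \<open>y\<close>.
  The recursion variable of \<open>Prec\<close> and the search variable of \<open>Mu\<close> are the first argument.
\<close>

inductive computes :: "recf \<Rightarrow> nat list \<Rightarrow> nat \<Rightarrow> bool" where
  Zero: "computes Zero xs 0"
| Succ: "computes Succ [x] (Suc x)"
| Proj: "i < length xs \<Longrightarrow> computes (Proj i) xs (xs ! i)"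
| Comp: "length ys = length gs \<Longrightarrow> (\<And>i. i < length gs \<Longrightarrow> computes (gs ! i) xs (ys ! i)) \<Longrightarrow>
    computes f ys z \<Longrightarrow> computes (Comp f gs) xs z"
| Prec_0: "computes f xs y \<Longrightarrow> computes (Prec f g) (0 # xs) y"
| Prec_Suc: "computes (Prec f g) (n # xs) y \<Longrightarrow> computes g (n # y # xs) z \<Longrightarrow>
    computes (Prec f g) (Suc n # xs) z"
| Mu: "(\<And>i. i < n \<Longrightarrow> \<exists>y>0. computes f (i # xs) y) \<Longrightarrow> computes f (n # xs) 0 \<Longrightarrow>
    computes (Mu f) xs n"

lemma computes_deterministic: "computes p xs y \<Longrightarrow> computes p xs z \<Longrightarrow> y = z"
proof (induction arbitrary: z rule: computes.induct)
  case (Comp ys gs xs f w)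
  from Comp.prems obtain ys' where ys': "length ys' = length gs"
    "\<And>i. i < length gs \<Longrightarrow> computes (gs ! i) xs (ys' ! i)" "computes f ys' z"
    by (cases rule: computes.cases) auto
  have "ys = ys'"
    using Comp.hyps(1) Comp.IH(1) ys'(1,2) by (intro nth_equalityI) auto
  then show ?case using Comp.IH(2) ys'(3) by blast
next
  case (Prec_Suc f g n xs y w)
  from Prec_Suc.prems show ?case
    by (cases rule: computes.cases) (use Prec_Suc.IH in blast)
next
  case (Mu n f xs)
  from Mu.prems have z: "\<forall>i<z. \<exists>y>0. computes f (i # xs) y" "computes f (z # xs) 0"
    by (cases rule: computes.cases; auto)+
  have "\<not> n < z" using z(1) Mu.IH(2) by fastforce
  moreover have "\<not> z < n" using z(2) Mu.IH(1) by fastforce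
  ultimately show ?case by simp
next
  case (Prec_0 f xs y g)
  from Prec_0.prems show ?case
    by (cases rule: computes.cases) (use Prec_0.IH in blast)
qed (erule computes.cases; simp)+

section \<open>Computable subfields\<close>

definition is_subfield :: "'k::field set \<Rightarrow> bool" where
  "is_subfield K0 \<longleftrightarrow> 0 \<in> K0 \<and> 1 \<in> K0 \<and>
     (\<forall>a\<in>K0. \<forall>b\<in>K0. a + b \<in> K0 \<and> a * b \<in> K0) \<and>
     (\<forall>a\<in>K0. - a \<in> K0 \<and> inverse a \<in> K0)"

text \<open>
  A computable field in the sense of Rabin: the elements have unique codes, the set of codes is
  decidable, and addition and multiplication are computable on codes. (Negation, inversion and
  the codes of 0 and 1 are then computable as well, the first two by unbounded search.)
\<close>

definition computable_subfield :: "'k::field set \<Rightarrow> ('k \<Rightarrow> nat) \<Rightarrow> bool" where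
  "computable_subfield K0 c \<longleftrightarrow> is_subfield K0 \<and> inj_on c K0 \<and>
     (\<exists>p. \<forall>i. computes p [i] (if i \<in> c ` K0 then 1 else 0)) \<and>
     (\<exists>p. \<forall>a\<in>K0. \<forall>b\<in>K0. computes p [c a, c b] (c (a + b))) \<and>
     (\<exists>p. \<forall>a\<in>K0. \<forall>b\<in>K0. computes p [c a, c b] (c (a * b)))"

section \<open>\<open>M\<close>-polynomials and \<open>M\<close>-sequences\<close>

text \<open>
  The indeterminate \<open>\<sigma>\<^sup>m(X\<^sub>i)\<close> is the pair \<open>(i, m)\<close>, with \<open>i\<close> counted from 0. The ring \<open>k\<^sup>M\<close> is
  \<open>'m \<Rightarrow> 'k\<close> with the pointwise operations of \<^theory>\<open>HOL-Library.Function_Algebras\<close>.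
\<close>

abbreviation "keys \<equiv> Poly_Mapping.keys"
abbreviation "lookup \<equiv> Poly_Mapping.lookup"

type_synonym 'm mon = "(nat \<times> 'm) \<Rightarrow>\<^sub>0 nat"
type_synonym ('m, 'k) mpoly = "'m mon \<Rightarrow>\<^sub>0 'k"

definition M_polys :: "'k::field set \<Rightarrow> nat \<Rightarrow> ('m, 'k) mpoly set" where
  "M_polys K0 n = {p. \<forall>t\<in>keys p. lookup p t \<in> K0 \<and> (\<forall>v\<in>keys t. fst v < n)}"

definition const :: "'k::field \<Rightarrow> ('m, 'k) mpoly" where
  "const a = Poly_Mapping.single 0 a"

definition indet :: "nat \<Rightarrow> 'm \<Rightarrow> ('m, 'k::field) mpoly" where
  "indet i m = Poly_Mapping.single (Poly_Mapping.single (i, m) 1) 1"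

definition shift_mon :: "'m::comm_monoid_add \<Rightarrow> 'm mon \<Rightarrow> 'm mon" where
  "shift_mon m t = (\<Sum>v\<in>keys t. Poly_Mapping.single (fst v, m + snd v) (lookup t v))"

definition shift_poly :: "'m::comm_monoid_add \<Rightarrow> ('m, 'k::field) mpoly \<Rightarrow> ('m, 'k) mpoly" where
  "shift_poly m p = (\<Sum>t\<in>keys p. Poly_Mapping.single (shift_mon m t) (lookup p t))"

definition shift_seq :: "'m::comm_monoid_add \<Rightarrow> ('m \<Rightarrow> 'k) \<Rightarrow> ('m \<Rightarrow> 'k)" where
  "shift_seq m x = (\<lambda>l. x (l + m))"

text \<open>
  \<open>\<phi>\<close> restricts to a \<open>k\<^sub>0\<close>-algebra morphism from the ring of \<open>M\<close>-polynomials over \<open>k\<^sub>0\<close> in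
  \<open>X\<^sub>0, \<dots>, X\<^sub>n\<^sub>-\<^sub>1\<close> to \<open>k\<^sup>M\<close> that commutes with the \<open>M\<close>-action and sends each \<open>X\<^sub>i\<close> to \<open>x i\<close>.
\<close>

definition M_morphism ::
  "'k::field set \<Rightarrow> nat \<Rightarrow> (nat \<Rightarrow> 'm::comm_monoid_add \<Rightarrow> 'k) \<Rightarrow> (('m, 'k) mpoly \<Rightarrow> ('m \<Rightarrow> 'k)) \<Rightarrow> bool"
where
  "M_morphism K0 n x \<phi> \<longleftrightarrow>
     (\<forall>a\<in>K0. \<phi> (const a) = (\<lambda>_. a)) \<and>
     (\<forall>p\<in>M_polys K0 n. \<forall>q\<in>M_polys K0 n. \<phi> (p + q) = \<phi> p + \<phi> q \<and> \<phi> (p * q) = \<phi> p * \<phi> q) \<and>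
     (\<forall>m. \<forall>p\<in>M_polys K0 n. \<phi> (shift_poly m p) = shift_seq m (\<phi> p)) \<and>
     (\<forall>i<n. \<phi> (indet i 0) = x i)"

text \<open>
  A tuple in \<open>(k\<^sup>M)\<^sup>n\<close> is given by the values \<open>x i\<close> for \<open>i < n\<close>; the other values are irrelevant.
  The morphism \<open>\<phi>\<close> exists and is unique on \<open>M_polys K0 n\<close>, see \<open>M_morphism_exists\<close> and
  \<open>M_morphism_unique\<close> below.
\<close>

definition is_solution ::
  "'k::field set \<Rightarrow> nat \<Rightarrow> ('m::comm_monoid_add, 'k) mpoly set \<Rightarrow> (nat \<Rightarrow> 'm \<Rightarrow> 'k) \<Rightarrow> bool"
where
  "is_solution K0 n F x \<longleftrightarrow> (\<exists>\<phi>. M_morphism K0 n x \<phi> \<and> (\<forall>f\<in>F. \<phi> f = 0))"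

section \<open>The decision problem\<close>

text \<open>
  Finite sets of naturals are coded canonically by \<^const>\<open>set_encode\<close>, and finitely supported
  functions as the finite set of codes of the pairs in their graph. Hence
  \<open>encode_system em c\<close> is injective on pairs of \<open>n\<close> and a finite subset of \<open>M_polys K0 n\<close>, if \<open>em\<close>
  is injective and \<open>c\<close> is injective on \<open>K0\<close>.
\<close>

definition encode_pm :: "('a \<Rightarrow> nat) \<Rightarrow> ('b \<Rightarrow> nat) \<Rightarrow> ('a \<Rightarrow>\<^sub>0 'b::zero) \<Rightarrow> nat" where
  "encode_pm ea eb p = set_encode ((\<lambda>a. prod_encode (ea a, eb (lookup p a))) ` keys p)"

definition encode_mon :: "('m \<Rightarrow> nat) \<Rightarrow> 'm mon \<Rightarrow> nat" where
  "encode_mon em = encode_pm (\<lambda>(i, m). prod_encode (i, em m)) (\<lambda>e. e)"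

definition encode_mpoly :: "('m \<Rightarrow> nat) \<Rightarrow> ('k::field \<Rightarrow> nat) \<Rightarrow> ('m, 'k) mpoly \<Rightarrow> nat" where
  "encode_mpoly em c = encode_pm (encode_mon em) c"

definition encode_system ::
  "('m \<Rightarrow> nat) \<Rightarrow> ('k::field \<Rightarrow> nat) \<Rightarrow> nat \<Rightarrow> ('m, 'k) mpoly set \<Rightarrow> nat" where
  "encode_system em c n F = prod_encode (n, set_encode (encode_mpoly em c ` F))"

text \<open>
  \<open>em\<close> and \<open>c\<close> are the codings of \<open>M\<close> and of \<open>k\<^sub>0\<close>; \<open>k\<close> is the type \<open>'k\<close>. The behaviour of the
  algorithm on numbers that do not code a system is unconstrained.
\<close>

definition solvability_decidable ::
  "('m::comm_monoid_add \<Rightarrow> nat) \<Rightarrow> 'k::field set \<Rightarrow> ('k \<Rightarrow> nat) \<Rightarrow> bool" where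
  "solvability_decidable em K0 c \<longleftrightarrow>
     (\<exists>p. \<forall>n. \<forall>F :: ('m, 'k) mpoly set. finite F \<longrightarrow> F \<subseteq> M_polys K0 n \<longrightarrow>
        computes p [encode_system em c n F] (if \<exists>x. is_solution K0 n F x then 1 else 0))"

definition encode_N2 :: "nat \<times> nat \<Rightarrow> nat" where
  "encode_N2 = prod_encode"

definition encode_Z2 :: "int \<times> int \<Rightarrow> nat" where
  "encode_Z2 = (\<lambda>(a, b). prod_encode (int_encode a, int_encode b))"

section \<open>Existence and uniqueness of the morphism\<close>

definition eval_mon :: "(nat \<Rightarrow> 'm::comm_monoid_add \<Rightarrow> 'k::field) \<Rightarrow> 'm mon \<Rightarrow> 'm \<Rightarrow> 'k" where
  "eval_mon x t l = (\<Prod>v\<in>keys t. x (fst v) (l + snd v) ^ lookup t v)"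

definition eval_mpoly ::
  "(nat \<Rightarrow> 'm::comm_monoid_add \<Rightarrow> 'k::field) \<Rightarrow> ('m, 'k) mpoly \<Rightarrow> 'm \<Rightarrow> 'k" where
  "eval_mpoly x p l = (\<Sum>t\<in>keys p. lookup p t * eval_mon x t l)"

lemma eval_mon_superset:
  assumes "finite A" "keys t \<subseteq> A"
  shows "eval_mon x t l = (\<Prod>v\<in>A. x (fst v) (l + snd v) ^ lookup t v)"
  unfolding eval_mon_def
  by (rule prod.mono_neutral_left) (use assms in \<open>auto simp: in_keys_iff\<close>)

lemma eval_mpoly_superset:
  assumes "finite A" "keys p \<subseteq> A"
  shows "eval_mpoly x p l = (\<Sum>t\<in>A. lookup p t * eval_mon x t l)"
  unfolding eval_mpoly_def
  by (rule sum.mono_neutral_left) (use assms in \<open>auto simp: in_keys_iff\<close>)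

lemma eval_mon_0 [simp]: "eval_mon x 0 l = 1"
  by (simp add: eval_mon_def)

lemma eval_mon_single [simp]:
  "eval_mon x (Poly_Mapping.single v e) l = x (fst v) (l + snd v) ^ e"
  by (simp add: eval_mon_def)

lemma eval_mon_add: "eval_mon x (s + t) l = eval_mon x s l * eval_mon x t l"
  using eval_mon_superset[of "keys s \<union> keys t" "s + t" x l]
    eval_mon_superset[of "keys s \<union> keys t" s x l] eval_mon_superset[of "keys s \<union> keys t" t x l]
    Poly_Mapping.keys_add[of s t]
  by (simp add: lookup_add power_add prod.distrib)

lemma eval_mon_sum: "eval_mon x (\<Sum>a\<in>A. f a) l = (\<Prod>a\<in>A. eval_mon x (f a) l)"
  by (induction A rule: infinite_finite_induct) (simp_all add: eval_mon_add)

lemma eval_mpoly_0 [simp]: "eval_mpoly x 0 l = 0"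
  by (simp add: eval_mpoly_def)

lemma eval_mpoly_single [simp]: "eval_mpoly x (Poly_Mapping.single t a) l = a * eval_mon x t l"
  by (simp add: eval_mpoly_def)

lemma eval_mpoly_add: "eval_mpoly x (p + q) l = eval_mpoly x p l + eval_mpoly x q l"
  using eval_mpoly_superset[of "keys p \<union> keys q" "p + q" x l]
    eval_mpoly_superset[of "keys p \<union> keys q" p x l] eval_mpoly_superset[of "keys p \<union> keys q" q x l]
    Poly_Mapping.keys_add[of p q]
  by (simp add: lookup_add distrib_right sum.distrib)

lemma eval_mpoly_sum: "eval_mpoly x (\<Sum>a\<in>A. f a) l = (\<Sum>a\<in>A. eval_mpoly x (f a) l)"
  by (induction A rule: infinite_finite_induct) (simp_all add: eval_mpoly_add)

lemma poly_mapping_eq_sum_single: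
  fixes p :: "'a \<Rightarrow>\<^sub>0 'b::comm_monoid_add"
  shows "p = (\<Sum>t\<in>keys p. Poly_Mapping.single t (lookup p t))"
proof (rule poly_mapping_eqI)
  fix t
  have "lookup (\<Sum>t\<in>keys p. Poly_Mapping.single t (lookup p t)) t =
      (\<Sum>s\<in>keys p. if t = s then lookup p t else 0)"
    unfolding lookup_sum by (rule sum.cong) (auto simp: lookup_single when_def)
  also have "\<dots> = lookup p t"
    by (simp add: in_keys_iff)
  finally show "lookup p t = lookup (\<Sum>t\<in>keys p. Poly_Mapping.single t (lookup p t)) t" ..
qed

lemma eval_mpoly_mult: "eval_mpoly x (p * q) l = eval_mpoly x p l * eval_mpoly x q l"
proof -
  have "p * q = (\<Sum>s\<in>keys p. \<Sum>t\<in>keys q. Poly_Mapping.single (s + t) (lookup p s * lookup q t))"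
    by (subst (1) poly_mapping_eq_sum_single[of p], subst (1) poly_mapping_eq_sum_single[of q])
       (simp only: sum_product mult_single)
  then show ?thesis
    by (simp add: eval_mpoly_sum eval_mon_add) (simp add: eval_mpoly_def sum_product mult_ac)
qed

lemma eval_mon_shift: "eval_mon x (shift_mon m t) l = eval_mon x t (l + m)"
  by (simp add: shift_mon_def eval_mon_sum) (simp add: eval_mon_def add_ac)

lemma eval_mpoly_shift: "eval_mpoly x (shift_poly m p) = shift_seq m (eval_mpoly x p)"
  by (rule ext)
     (simp add: shift_seq_def shift_poly_def eval_mpoly_sum eval_mon_shift, simp add: eval_mpoly_def)

lemma M_morphism_exists: "M_morphism K0 n x (eval_mpoly x)"
  unfolding M_morphism_def
  by (auto simp: fun_eq_iff const_def indet_def eval_mpoly_add eval_mpoly_mult eval_mpoly_shift)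

lemma shift_poly_indet: "shift_poly m (indet i 0) = indet i m"
  by (simp add: shift_poly_def indet_def shift_mon_def)

context
  fixes K0 :: "'k::field set" and n :: nat
  assumes K0: "is_subfield K0"
begin

lemma const_in_M_polys: "a \<in> K0 \<Longrightarrow> const a \<in> M_polys K0 n"
  by (auto simp: M_polys_def const_def)

lemma single_in_M_polys:
  "a \<in> K0 \<Longrightarrow> (\<And>v. v \<in> keys t \<Longrightarrow> fst v < n) \<Longrightarrow> Poly_Mapping.single t a \<in> M_polys K0 n"
  by (auto simp: M_polys_def)

lemma indet_in_M_polys: "i < n \<Longrightarrow> indet i m \<in> M_polys K0 n"
  unfolding indet_def by (rule single_in_M_polys) (use K0 in \<open>auto simp: is_subfield_def\<close>)

lemma M_polys_add: "p \<in> M_polys K0 n \<Longrightarrow> q \<in> M_polys K0 n \<Longrightarrow> p + q \<in> M_polys K0 n"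
proof -
  assume p: "p \<in> M_polys K0 n" and q: "q \<in> M_polys K0 n"
  have "lookup p t \<in> K0" "lookup q t \<in> K0" for t
    using p q K0 by (cases "t \<in> keys p"; cases "t \<in> keys q"; force simp: M_polys_def is_subfield_def in_keys_iff)+
  moreover have "fst v < n" if "t \<in> keys (p + q)" "v \<in> keys t" for t v
    using that p q Poly_Mapping.keys_add[of p q] unfolding M_polys_def by blast
  ultimately show ?thesis
    using K0 by (auto simp: M_polys_def lookup_add is_subfield_def)
qed

lemma M_morphism_mon:
  assumes \<phi>: "M_morphism K0 n x \<phi>" and a: "a \<in> K0"
    and A: "finite A" "\<And>v. v \<in> A \<Longrightarrow> fst v < n"
  shows "\<phi> (Poly_Mapping.single (\<Sum>v\<in>A. Poly_Mapping.single v (e v)) a) =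
     (\<lambda>l. a * (\<Prod>v\<in>A. x (fst v) (l + snd v) ^ e v))"
  using A
proof (induction A rule: finite_induct)
  case empty
  then show ?case using \<phi> a by (simp add: M_morphism_def const_def)
next
  case (insert v A)
  have mult: "\<phi> (p * q) = \<phi> p * \<phi> q" if "p \<in> M_polys K0 n" "q \<in> M_polys K0 n" for p q
    using \<phi> that by (simp add: M_morphism_def)
  have v: "fst v < n" using insert.prems by simp
  have one: "(1 :: 'k) \<in> K0" using K0 by (simp add: is_subfield_def)
  have "\<phi> (indet (fst v) (snd v)) = shift_seq (snd v) (\<phi> (indet (fst v) 0))"
    using \<phi> indet_in_M_polys[OF v, of 0] unfolding M_morphism_def
    by (metis shift_poly_indet)
  then have ind: "\<phi> (indet (fst v) (snd v)) = (\<lambda>l. x (fst v) (l + snd v))"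
    using \<phi> v by (simp add: M_morphism_def shift_seq_def)
  have pow: "\<phi> (Poly_Mapping.single (Poly_Mapping.single v d) 1) = (\<lambda>l. x (fst v) (l + snd v) ^ d)" for d
  proof (induction d)
    case 0
    then show ?case using \<phi> one by (simp add: M_morphism_def flip: const_def)
  next
    case (Suc d)
    have "Poly_Mapping.single (Poly_Mapping.single v (Suc d)) 1 =
        indet (fst v) (snd v) * Poly_Mapping.single (Poly_Mapping.single v d) (1 :: 'k)"
      by (simp add: indet_def mult_single flip: single_add)
    moreover have "Poly_Mapping.single (Poly_Mapping.single v d) (1 :: 'k) \<in> M_polys K0 n"
      by (rule single_in_M_polys) (use one v in \<open>auto split: if_splits\<close>)
    ultimately show ?case
      using mult[OF indet_in_M_polys[OF v]] Suc.IH ind by (simp add: fun_eq_iff)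
  qed
  let ?t = "\<Sum>v\<in>A. Poly_Mapping.single v (e v)"
  have "fst w < n" if "w \<in> keys ?t" for w
    using that keys_sum[of "\<lambda>v. Poly_Mapping.single v (e v)" A] insert.prems
    by (fastforce split: if_splits)
  then have "Poly_Mapping.single ?t a \<in> M_polys K0 n"
    by (intro single_in_M_polys a)
  moreover have "Poly_Mapping.single (Poly_Mapping.single v (e v)) (1 :: 'k) \<in> M_polys K0 n"
    by (rule single_in_M_polys) (use one v in \<open>auto split: if_splits\<close>)
  moreover have "Poly_Mapping.single (\<Sum>v\<in>insert v A. Poly_Mapping.single v (e v)) a =
      Poly_Mapping.single (Poly_Mapping.single v (e v)) 1 * Poly_Mapping.single ?t a"
    using insert.hyps by (simp add: mult_single)
  ultimately have "\<phi> (Poly_Mapping.single (\<Sum>v\<in>insert v A. Poly_Mapping.single v (e v)) a) =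
      \<phi> (Poly_Mapping.single (Poly_Mapping.single v (e v)) 1) * \<phi> (Poly_Mapping.single ?t a)"
    by (simp add: mult)
  then show ?case
    using insert.IH insert.prems insert.hyps by (simp add: pow fun_eq_iff mult_ac)
qed

lemma M_morphism_unique:
  assumes \<phi>: "M_morphism K0 n x \<phi>" and p: "p \<in> M_polys K0 n"
  shows "\<phi> p = eval_mpoly x p"
proof -
  have "(\<Sum>t\<in>T. Poly_Mapping.single t (lookup p t)) \<in> M_polys K0 n \<and>
      \<phi> (\<Sum>t\<in>T. Poly_Mapping.single t (lookup p t)) = (\<lambda>l. \<Sum>t\<in>T. lookup p t * eval_mon x t l)"
    if "finite T" "T \<subseteq> keys p" for T
    using that
  proof (induction T rule: finite_induct)
    case empty
    have "(0 :: 'k) \<in> K0" using K0 by (simp add: is_subfield_def)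
    then have "\<phi> (const 0) = (\<lambda>_. 0)" using \<phi> unfolding M_morphism_def by blast
    then show ?case by (simp add: const_def M_polys_def)
  next
    case (insert t T)
    have t: "lookup p t \<in> K0" "\<And>v. v \<in> keys t \<Longrightarrow> fst v < n"
      using insert.prems p by (auto simp: M_polys_def)
    let ?s = "Poly_Mapping.single t (lookup p t)"
    let ?r = "\<Sum>t\<in>T. Poly_Mapping.single t (lookup p t)"
    have s: "?s \<in> M_polys K0 n" by (rule single_in_M_polys) (use t in auto)
    have r: "?r \<in> M_polys K0 n" using insert by simp
    have "\<phi> ?s = (\<lambda>l. lookup p t * eval_mon x t l)"
      using M_morphism_mon[OF \<phi> t(1) _ t(2), of "keys t" "lookup t"]
      by (simp add: eval_mon_def flip: poly_mapping_eq_sum_single)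
    moreover have "\<phi> (?s + ?r) = \<phi> ?s + \<phi> ?r"
      using \<phi> s r by (simp add: M_morphism_def)
    ultimately show ?case
      using insert M_polys_add[OF s r] by (simp add: fun_eq_iff)
  qed
  from this[of "keys p"] show ?thesis
    by (simp add: eval_mpoly_def fun_eq_iff flip: poly_mapping_eq_sum_single)
qed

lemma is_solution_iff:
  assumes "F \<subseteq> M_polys K0 n"
  shows "is_solution K0 n F x \<longleftrightarrow> (\<forall>f\<in>F. eval_mpoly x f = 0)"
  unfolding is_solution_def
  using assms M_morphism_exists[of K0 n x] M_morphism_unique[of x] by (metis subsetD)

end

end

theory Submission
  imports Defs "HOL-Library.Countable" "HOL-Computational_Algebra.Primes"
begin

text \<open>
  Suppose that a program \<open>D\<close> decides solvability, and let \<open>Q(n, S)\<close> be the result of \<open>D\<close> on the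
  system in \<open>n\<close> unknowns that consists of the polynomials coded by \<open>S\<close> and of the two polynomials
  \<open>X\<^sub>0 + (n + 1)\<close> and \<open>X\<^sub>1 + (S + 1)\<close>. We construct a system, coded by some \<open>(n, S)\<close>, which together
  with \<open>X\<^sub>0 + (a + 1)\<close> and \<open>X\<^sub>1 + (b + 1)\<close> is solvable iff \<open>Q(a, b) = 0\<close>, whenever \<open>Q(a, b)\<close> is defined.
  For \<open>(a, b) = (n, S)\<close> this is a contradiction.

  As the unknowns take values in a field of characteristic zero, a computation of a register machine
  fits into a single row of the grid. It remains to force rows in which arbitrarily long computations
  are started. For this, the columns \<open>i\<close> and the rows \<open>j\<close> are labelled with the largest power of 2
  dividing \<open>i\<close> and \<open>j\<close>, respectively (with 0 for 0). A row labelled \<open>L\<close> contains a counter modulo \<open>4 * L\<close> that is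
  synchronised with the columns labelled \<open>L\<close> and forces the existence of columns labelled \<open>2 * L\<close>, and
  vice versa; that every second row and column is labelled 1 is a local condition. The computation is
  restarted whenever the counter of the row vanishes.
\<close>

section \<open>Computable functions\<close>

text \<open>Only total functions are treated this way; they compute the code of a system from
  \<open>(a, b)\<close>. The decider may diverge on numbers that code no system, so it is composed
  with them as a program.\<close>

definition recursive :: "nat \<Rightarrow> (nat list \<Rightarrow> nat) \<Rightarrow> bool" where
  "recursive m f \<longleftrightarrow> (\<exists>p. \<forall>xs. length xs = m \<longrightarrow> computes p xs (f xs))"

lemma recursive_nth: "i < m \<Longrightarrow> recursive m (\<lambda>xs. xs ! i)"
  unfolding recursive_def by (rule exI[of _ "Proj i"]) (auto intro: computes.Proj)

lemma recursive_compose: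
  assumes g: "recursive (length fs) g" and fs: "\<And>f. f \<in> set fs \<Longrightarrow> recursive m f"
  shows "recursive m (\<lambda>xs. g (map (\<lambda>f. f xs) fs))"
proof -
  obtain p where p: "\<And>xs. length xs = length fs \<Longrightarrow> computes p xs (g xs)"
    using g unfolding recursive_def by blast
  have "\<forall>f\<in>set fs. \<exists>q. \<forall>xs. length xs = m \<longrightarrow> computes q xs (f xs)"
    using fs unfolding recursive_def by blast
  then obtain Q where Q: "\<And>f xs. f \<in> set fs \<Longrightarrow> length xs = m \<Longrightarrow> computes (Q f) xs (f xs)"
    by metis
  have "computes (Comp p (map Q fs)) xs (g (map (\<lambda>f. f xs) fs))" if "length xs = m" for xs
    by (rule computes.Comp[where ys = "map (\<lambda>f. f xs) fs"]) (auto intro: p Q that)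
  then show ?thesis unfolding recursive_def by blast
qed

lemma recursive_Suc: "recursive m f \<Longrightarrow> recursive m (\<lambda>xs. Suc (f xs))"
proof -
  assume f: "recursive m f"
  have "recursive 1 (\<lambda>xs. Suc (hd xs))"
    unfolding recursive_def
    by (rule exI[of _ Succ]) (auto simp: length_Suc_conv intro: computes.Succ)
  then show ?thesis
    using recursive_compose[of "[f]" "\<lambda>xs. Suc (hd xs)" m] f by simp
qed

lemma recursive_const: "recursive m (\<lambda>_. a)"
proof (induction a)
  case 0
  then show ?case unfolding recursive_def by (rule exI[of _ Zero]) (auto intro: computes.Zero)
qed (rule recursive_Suc)

lemma recursive_compose2:
  assumes "recursive 2 (\<lambda>xs. g (xs ! 0) (xs ! 1))" "recursive m f" "recursive m h"
  shows "recursive m (\<lambda>xs. g (f xs) (h xs))"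
  using recursive_compose[of "[f, h]" "\<lambda>xs. g (xs ! 0) (xs ! 1)" m] assms
  by (auto simp: numeral_2_eq_2)

lemma recursive_compose1:
  assumes "recursive 1 (\<lambda>xs. g (xs ! 0))" "recursive m f"
  shows "recursive m (\<lambda>xs. g (f xs))"
  using recursive_compose[of "[f]" "\<lambda>xs. g (xs ! 0)" m] assms by simp

lemma recursive_rec:
  assumes "recursive 2 (\<lambda>xs. g (xs ! 0) (xs ! 1))"
  shows "recursive 1 (\<lambda>xs. rec_nat a g (xs ! 0))"
proof -
  obtain p where p: "\<And>xs. length xs = 2 \<Longrightarrow> computes p xs (g (xs ! 0) (xs ! 1))"
    using assms unfolding recursive_def by blast
  obtain q where q: "\<And>xs. length xs = 0 \<Longrightarrow> computes q xs a"
    using recursive_const[of 0 a] unfolding recursive_def by blast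
  have "computes (Prec q p) [n] (rec_nat a g n)" for n
  proof (induction n)
    case 0
    then show ?case by (auto intro: computes.Prec_0 q)
  next
    case (Suc n)
    then show ?case using p[of "[n, rec_nat a g n]"] by (auto intro: computes.Prec_Suc)
  qed
  then show ?thesis
    unfolding recursive_def by (intro exI[of _ "Prec q p"]) (auto simp: length_Suc_conv)
qed

lemma recursive_add:
  assumes "recursive m f" "recursive m h" shows "recursive m (\<lambda>xs. f xs + h xs)"
proof (rule recursive_compose2[OF _ assms])
  have "computes (Prec (Proj 0) (Comp Succ [Proj 1])) [n, x] (n + x)" for n x
  proof (induction n)
    case 0
    then show ?case using computes.Proj[of 0 "[x]"] by (auto intro: computes.Prec_0)
  next
    case (Suc n)
    have "computes (Comp Succ [Proj 1]) [n, n + x, x] (Suc (n + x))"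
      using computes.Proj[of 1 "[n, n + x, x]"]
      by (intro computes.Comp[where ys = "[n + x]"]) (auto intro: computes.Succ)
    then show ?case using Suc by (auto intro: computes.Prec_Suc)
  qed
  then show "recursive 2 (\<lambda>xs. xs ! 0 + xs ! 1)"
    unfolding recursive_def
    by (intro exI[of _ "Prec (Proj 0) (Comp Succ [Proj 1])"])
       (auto simp: length_Suc_conv numeral_2_eq_2)
qed

lemma recursive_power2:
  assumes "recursive m f" shows "recursive m (\<lambda>xs. 2 ^ f xs)"
proof (rule recursive_compose1[OF _ assms])
  have "rec_nat 1 (\<lambda>_ y. y + y) n = (2 :: nat) ^ n" for n by (induction n) auto
  then show "recursive 1 (\<lambda>xs. 2 ^ (xs ! 0))"
    using recursive_rec[of "\<lambda>_ y. y + y" 1] by (simp add: recursive_add recursive_nth)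
qed

lemma recursive_prod_encode:
  assumes "recursive m f" "recursive m h" shows "recursive m (\<lambda>xs. prod_encode (f xs, h xs))"
proof -
  have "rec_nat 0 (\<lambda>n y. y + Suc n) n = triangle n" for n by (induction n) auto
  then have "recursive 1 (\<lambda>xs. triangle (xs ! 0))"
    using recursive_rec[of "\<lambda>n y. y + Suc n" 0]
    by (simp add: recursive_add recursive_Suc recursive_nth)
  then have "recursive m (\<lambda>xs. triangle (f xs + h xs) + f xs)"
    by (rule recursive_add[OF recursive_compose1[of triangle, OF _ recursive_add[OF assms]] assms(1)])
  then show ?thesis by (simp add: prod_encode_def)
qed

section \<open>A programming language\<close>

text \<open>Assignments are affine, \<open>t := a * r + b\<close>, and \<open>While r q c\<close>
  runs while the registers \<open>r\<close> and \<open>q\<close> differ, so a single step amounts to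
  polynomial conditions over a field.\<close>

datatype com =
    Skip
  | Assign nat nat nat nat
  | Seq com com
  | While nat nat com

text \<open>Through \<open>to_nat\<close>, the program still to be run becomes a number that a point
  of the grid can store.\<close>

instance com :: countable by countable_datatype

inductive exec :: "com \<Rightarrow> (nat \<Rightarrow> nat) \<Rightarrow> (nat \<Rightarrow> nat) \<Rightarrow> bool" where
  Skip: "exec Skip s s"
| Assign: "exec (Assign t a r b) s (s(t := a * s r + b))"
| Seq: "exec c s s' \<Longrightarrow> exec c' s' s'' \<Longrightarrow> exec (Seq c c') s s''"
| While_end: "s r = s q \<Longrightarrow> exec (While r q c) s s"
| While_step: "s r \<noteq> s q \<Longrightarrow> exec c s s' \<Longrightarrow> exec (While r q c) s' s'' \<Longrightarrow> exec (While r q c) s s''"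

text \<open>
  \<open>instr c = (r, q, c', c'', t, a, p, b)\<close> describes one step of \<open>c\<close>: it continues with \<open>c'\<close> or with
  \<open>c''\<close>, according to whether the registers \<open>r\<close> and \<open>q\<close> are equal or not, and sets
  \<open>t := a * p + b\<close>.
\<close>

fun instr :: "com \<Rightarrow> nat \<times> nat \<times> com \<times> com \<times> nat \<times> nat \<times> nat \<times> nat" where
  "instr Skip = (0, 0, Skip, Skip, 0, 1, 0, 0)"
| "instr (Assign t a p b) = (0, 0, Skip, Skip, t, a, p, b)"
| "instr (Seq c d) = (if c = Skip then (0, 0, d, d, 0, 1, 0, 0) else
     (case instr c of (r, q, c', c'', u) \<Rightarrow> (r, q, Seq c' d, Seq c'' d, u)))"
| "instr (While r q c) = (r, q, Skip, Seq c (While r q c), 0, 1, 0, 0)"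

fun step :: "com \<times> (nat \<Rightarrow> nat) \<Rightarrow> com \<times> (nat \<Rightarrow> nat)" where
  "step (c, s) = (case instr c of (r, q, c', c'', t, a, p, b) \<Rightarrow>
     (if s r = s q then c' else c'', s(t := a * s p + b)))"

text \<open>A finite set containing every program that can remain after some steps, so that finitely
  many clauses describe all transitions.\<close>

fun residuals :: "com \<Rightarrow> com set" where
  "residuals Skip = {Skip}"
| "residuals (Assign t a p b) = {Assign t a p b, Skip}"
| "residuals (Seq c d) = (\<lambda>c'. Seq c' d) ` residuals c \<union> residuals d"
| "residuals (While r q c) =
     {While r q c, Skip} \<union> (\<lambda>c'. Seq c' (While r q c)) ` residuals c"

lemma finite_residuals: "finite (residuals c)"
  by (induction c) auto

lemma self_in_residuals: "c \<in> residuals c"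
  by (induction c) auto

lemma residuals_instr:
  "d \<in> residuals c \<Longrightarrow> instr d = (r, q, c', c'', u) \<Longrightarrow> c' \<in> residuals c \<and> c'' \<in> residuals c"
proof (induction c arbitrary: d r q c' c'' u)
  case (Seq c1 c2)
  consider d1 where "d = Seq d1 c2" "d1 \<in> residuals c1" | "d \<in> residuals c2"
    using Seq.prems(1) by auto
  then show ?case
  proof cases
    case 1
    obtain r' q' e' e'' u' where i: "instr d1 = (r', q', e', e'', u')" by (cases "instr d1")
    show ?thesis
      using Seq.prems(2) Seq.IH(1)[OF 1(2) i] self_in_residuals[of c2]
      by (cases "d1 = Skip") (auto simp: 1(1) i)
  next
    case 2
    then show ?thesis using Seq.IH(2)[OF _ Seq.prems(2)] by simp
  qed
next
  case (While a b c)
  consider d1 where "d = Seq d1 (While a b c)" "d1 \<in> residuals c" | "d = Skip" | "d = While a b c"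
    using While.prems(1) by auto
  then show ?case
  proof cases
    case 1
    obtain r' q' e' e'' u' where i: "instr d1 = (r', q', e', e'', u')" by (cases "instr d1")
    show ?thesis
      using While.prems(2) While.IH[OF 1(2) i] by (cases "d1 = Skip") (auto simp: 1(1) i)
  next
    case 3
    then show ?thesis using While.prems(2) self_in_residuals[of c] by auto
  qed (use While.prems(2) in auto)
qed auto

lemma residuals_step: "fst cs \<in> residuals c \<Longrightarrow> fst (step cs) \<in> residuals c"
  by (cases cs) (auto split: prod.splits dest: residuals_instr)

section \<open>From terminating executions to iterated steps\<close>

lemma step_Skip: "step (Skip, s) = (Skip, s)"
  by simp

lemma steps_Skip: "(step ^^ n) (Skip, s) = (Skip, s)"
  by (induction n) auto

text \<open>The number of steps is not preserved: discarding the finished first component costs a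
  step, and steps idled in \<open>Skip\<close> are dropped.\<close>

lemma steps_Seq:
  "(step ^^ n) (c, s) = (Skip, s') \<Longrightarrow> \<exists>k. (step ^^ k) (Seq c d, s) = (d, s')"
proof (induction n arbitrary: c s)
  case 0
  then show ?case by (intro exI[of _ 1]) auto
next
  case (Suc n)
  show ?case
  proof (cases "c = Skip")
    case True
    then have "s' = s" using Suc.prems steps_Skip[of "Suc n" s] by simp
    then show ?thesis using True by (intro exI[of _ 1]) auto
  next
    case False
    obtain c1 s1 where 1: "step (c, s) = (c1, s1)" by fastforce
    then have "(step ^^ n) (c1, s1) = (Skip, s')"
      using Suc.prems by (simp only: funpow_Suc_right o_def)
    then obtain k where "(step ^^ k) (Seq c1 d, s1) = (d, s')" using Suc.IH by blast
    moreover have "step (Seq c d, s) = (Seq c1 d, s1)"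
      using False 1 by (auto split: prod.splits)
    ultimately have "(step ^^ Suc k) (Seq c d, s) = (d, s')"
      by (simp only: funpow_Suc_right o_def)
    then show ?thesis by blast
  qed
qed

lemma steps_trans:
  "(step ^^ m) x = y \<Longrightarrow> (step ^^ n) y = z \<Longrightarrow> (step ^^ (n + m)) x = z"
  by (simp add: funpow_add)

lemma exec_steps: "exec c s s' \<Longrightarrow> \<exists>n. (step ^^ n) (c, s) = (Skip, s')"
proof (induction rule: exec.induct)
  case (Skip s)
  then show ?case by (intro exI[of _ 0]) simp
next
  case (Assign t a r b s)
  then show ?case by (intro exI[of _ 1]) (simp add: fun_upd_def)
next
  case (Seq c s s' c' s'')
  then show ?case using steps_Seq steps_trans by metis
next
  case (While_end s r q c)
  then show ?case by (intro exI[of _ 1]) simp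
next
  case (While_step s r q c s' s'')
  have "(step ^^ 1) (While r q c, s) = (Seq c (While r q c), s)" using While_step.hyps by simp
  then show ?case using While_step.IH steps_Seq steps_trans by metis
qed

text \<open>\<open>step\<close> fixes halted states, so both stores are the one present after
  \<open>m + n\<close> steps.\<close>

lemma steps_Skip_unique:
  assumes "(step ^^ m) x = (Skip, s)" "(step ^^ n) x = (Skip, s')"
  shows "s = s'"
proof -
  have "(step ^^ n) ((step ^^ m) x) = (step ^^ m) ((step ^^ n) x)"
    by (simp add: add.commute flip: funpow_add comp_apply[of "step ^^ _" "step ^^ _"])
  then show ?thesis using assms by (simp add: steps_Skip)
qed

section \<open>Compiling partial recursive functions\<close>

text \<open>
  The arguments are read from the registers \<open>rs\<close>; registers from \<open>w\<close> on are scratch space.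
\<close>

definition implements :: "com \<Rightarrow> recf \<Rightarrow> nat list \<Rightarrow> nat \<Rightarrow> nat \<Rightarrow> bool" where
  "implements c f rs t w \<longleftrightarrow> (\<forall>s y. computes f (map s rs) y \<longrightarrow>
     (\<exists>s'. exec c s s' \<and> s' t = y \<and> (\<forall>i<w. i \<noteq> t \<longrightarrow> s' i = s i)))"

inductive_cases computes_SuccE: "computes Succ xs y"
inductive_cases computes_ZeroE: "computes Zero xs y"
inductive_cases computes_ProjE: "computes (Proj i) xs y"
inductive_cases computes_CompE: "computes (Comp f gs) xs y"
inductive_cases computes_PrecE: "computes (Prec f g) xs y"
inductive_cases computes_Prec_SucE: "computes (Prec f g) (Suc n # xs) y"
inductive_cases computes_Prec_0E: "computes (Prec f g) (0 # xs) y"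
inductive_cases computes_MuE: "computes (Mu f) xs y"

lemma implementsD:
  assumes "implements c f rs t w" "computes f (map s rs) y"
  obtains s' where "exec c s s'" "s' t = y" "\<And>i. i < w \<Longrightarrow> i \<noteq> t \<Longrightarrow> s' i = s i"
  using assms unfolding implements_def by blast

text \<open>The arguments lie below \<open>w\<close> and the values are stored from \<open>w\<close>
  on, so each evaluation leaves the arguments and the earlier values intact.\<close>

lemma compile_all:
  assumes "\<And>i. i < n \<Longrightarrow> implements (C i) (gs ! i) rs (w + i) (w + length gs)"
    and "n \<le> length gs" "\<And>r. r \<in> set rs \<Longrightarrow> r < w"
  shows "\<exists>c. \<forall>s ys. (\<forall>i<n. computes (gs ! i) (map s rs) (ys ! i)) \<longrightarrow>
    (\<exists>s'. exec c s s' \<and> (\<forall>i<n. s' (w + i) = ys ! i) \<and> (\<forall>i<w. s' i = s i))"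
  using assms(1,2)
proof (induction n)
  case 0
  then show ?case by (intro exI[of _ Skip]) (auto intro: exec.Skip)
next
  case (Suc n)
  then obtain c where c: "\<And>s ys. (\<forall>i<n. computes (gs ! i) (map s rs) (ys ! i)) \<Longrightarrow>
    (\<exists>s'. exec c s s' \<and> (\<forall>i<n. s' (w + i) = ys ! i) \<and> (\<forall>i<w. s' i = s i))"
    by (metis Suc_leD less_SucI)
  show ?case
  proof (intro exI[of _ "Seq c (C n)"] allI impI)
    fix s ys assume ys: "\<forall>i<Suc n. computes (gs ! i) (map s rs) (ys ! i)"
    then obtain s1 where s1: "exec c s s1" "\<forall>i<n. s1 (w + i) = ys ! i" "\<forall>i<w. s1 i = s i"
      using c[of s ys] by auto
    then have "map s1 rs = map s rs" using assms(3) by auto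
    with ys have "computes (gs ! n) (map s1 rs) (ys ! n)" by (metis lessI)
    then obtain s2 where "exec (C n) s1 s2" "s2 (w + n) = ys ! n"
      "\<And>i. i < w + length gs \<Longrightarrow> i \<noteq> w + n \<Longrightarrow> s2 i = s1 i"
      using implementsD Suc.prems(1)[of n] by (metis lessI)
    with s1 Suc.prems(2) show "\<exists>s'. exec (Seq c (C n)) s s' \<and> (\<forall>i<Suc n. s' (w + i) = ys ! i) \<and> (\<forall>i<w. s' i = s i)"
      by (intro exI[of _ s2]) (auto simp: less_Suc_eq intro: exec.Seq)
  qed
qed

text \<open>The compiled loop climbs from 0 to \<open>n\<close>, so it needs the values at all
  intermediate stages; they occur inside the derivation for \<open>n\<close>.\<close>

lemma computes_Prec_lower:
  "computes (Prec f g) (n # xs) y \<Longrightarrow> m \<le> n \<Longrightarrow> \<exists>z. computes (Prec f g) (m # xs) z"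
proof (induction n arbitrary: y)
  case (Suc n)
  obtain z where "computes (Prec f g) (n # xs) z"
    using Suc.prems(1) by (rule computes_Prec_SucE)
  then show ?case using Suc by (cases "m = Suc n") auto
qed auto

text \<open>Loop invariant: register \<open>w\<close> holds the stage \<open>m\<close>,
  \<open>Suc w\<close> the value \<open>z\<close> at that stage; \<open>Suc (Suc w)\<close> receives
  the next value, and \<open>k\<close> rounds remain.\<close>

lemma compile_Prec_loop:
  assumes g: "implements c g (w # Suc w # rs) (Suc (Suc w)) (w + 3)"
    and rs: "\<And>r. r \<in> set rs \<Longrightarrow> r < w" and q: "q < w"
  shows "computes (Prec f g) (n # map s rs) y \<Longrightarrow> computes (Prec f g) (m # map s rs) z \<Longrightarrow> n = m + k \<Longrightarrow>
    s q = n \<Longrightarrow> s w = m \<Longrightarrow> s (Suc w) = z \<Longrightarrow>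
    \<exists>s'. exec (While w q (Seq c (Seq (Assign (Suc w) 1 (Suc (Suc w)) 0) (Assign w 1 w 1)))) s s' \<and>
      s' (Suc w) = y \<and> (\<forall>i<w. s' i = s i)"
proof (induction k arbitrary: m z s)
  case 0
  then have "y = z" using computes_deterministic by auto
  then show ?case using 0 by (intro exI[of _ s]) (auto intro: exec.While_end)
next
  case (Suc k)
  let ?b = "Seq c (Seq (Assign (Suc w) 1 (Suc (Suc w)) 0) (Assign w 1 w 1))"
  obtain z' where z': "computes (Prec f g) (Suc m # map s rs) z'"
    using computes_Prec_lower[OF Suc.prems(1), of "Suc m"] Suc.prems(3) by auto
  then obtain z0 where "computes (Prec f g) (m # map s rs) z0" "computes g (m # z0 # map s rs) z'"
    by (metis computes_Prec_SucE)
  then have "computes g (map s (w # Suc w # rs)) z'"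
    using Suc.prems computes_deterministic by fastforce
  then obtain s1 where s1: "exec c s s1" "s1 (Suc (Suc w)) = z'" "\<And>i. i < w + 3 \<Longrightarrow> i \<noteq> Suc (Suc w) \<Longrightarrow> s1 i = s i"
    using implementsD[OF g] by blast
  define s2 where "s2 = s1(Suc w := z', w := Suc m)"
  have "s1 w = m" using s1(3)[of w] Suc.prems by simp
  then have ex: "exec ?b s s2"
    unfolding s2_def using s1(1,2) Suc.prems
    by (intro exec.Seq[OF s1(1)] exec.Seq[OF exec.Assign])
       (use exec.Assign[of w 1 w 1 "s1(Suc w := z')"] in simp)
  have eq: "\<forall>i<w. s2 i = s i" using s1(3) by (simp add: s2_def)
  then have "map s2 rs = map s rs" using rs by auto
  moreover have "s2 q = n" using q eq Suc.prems by simp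
  moreover have "s2 w = Suc m" "s2 (Suc w) = z'" by (simp_all add: s2_def)
  ultimately obtain s' where "exec (While w q ?b) s2 s'" "s' (Suc w) = y" "\<forall>i<w. s' i = s2 i"
    using Suc.IH[of s2 "Suc m" z'] Suc.prems(1,3) z' by (auto simp del: map_eq_conv)
  moreover have "s w \<noteq> s q" using Suc.prems by simp
  ultimately show ?case using ex eq by (metis exec.While_step)
qed

text \<open>Loop invariant: \<open>w\<close> holds the candidate \<open>m\<close>,
  \<open>Suc w\<close> the value of \<open>f\<close> there, and \<open>Suc (Suc w)\<close> a 0 for
  comparison. Values at candidates below \<open>n\<close> are positive, so the loop ends exactly at
  \<open>n\<close>.\<close>

lemma compile_Mu_loop:
  assumes f: "implements c f (w # rs) (Suc w) (w + 3)"
    and rs: "\<And>r. r \<in> set rs \<Longrightarrow> r < w"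
  shows "computes (Mu f) (map s rs) n \<Longrightarrow> n = m + k \<Longrightarrow>
    s w = m \<Longrightarrow> computes f (m # map s rs) (s (Suc w)) \<Longrightarrow> s (Suc (Suc w)) = 0 \<Longrightarrow>
    \<exists>s'. exec (While (Suc w) (Suc (Suc w)) (Seq (Assign w 1 w 1) c)) s s' \<and>
      s' w = n \<and> (\<forall>i<w. s' i = s i)"
proof (induction k arbitrary: m s)
  case 0
  from 0(1) have "computes f (n # map s rs) 0" by (metis computes_MuE)
  then have "s (Suc w) = 0" using 0 computes_deterministic by auto
  then show ?case using 0 by (intro exI[of _ s]) (auto intro: exec.While_end)
next
  case (Suc k)
  have mu: "\<And>i. i < n \<Longrightarrow> \<exists>y>0. computes f (i # map s rs) y" "computes f (n # map s rs) 0"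
    using computes_MuE[OF Suc.prems(1)] by metis+
  have ne: "s (Suc w) \<noteq> s (Suc (Suc w))"
    using mu(1)[of m] Suc.prems computes_deterministic by force
  obtain y where y: "computes f (Suc m # map s rs) y"
    using mu Suc.prems(2) by (metis add_Suc_right le_add1 le_neq_implies_less not_less_eq_eq add_Suc)
  define s1 where "s1 = s(w := Suc m)"
  have m1: "map s1 rs = map s rs" using rs by (auto simp: s1_def)
  moreover have "s1 w = Suc m" by (simp add: s1_def)
  ultimately have "computes f (map s1 (w # rs)) y" using y by (simp only: list.map)
  then obtain s2 where s2: "exec c s1 s2" "s2 (Suc w) = y" "\<And>i. i < w + 3 \<Longrightarrow> i \<noteq> Suc w \<Longrightarrow> s2 i = s1 i"
    using implementsD[OF f] by blast
  have "exec (Assign w 1 w 1) s s1"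
    using exec.Assign[of w 1 w 1 s] Suc.prems by (simp add: s1_def)
  then have ex: "exec (Seq (Assign w 1 w 1) c) s s2" using s2(1) by (rule exec.Seq)
  have eq: "\<forall>i<w. s2 i = s i" using s2(3) by (simp add: s1_def)
  then have "map s2 rs = map s rs" using rs by auto
  moreover have "s2 w = Suc m" "s2 (Suc (Suc w)) = 0"
    using s2(3)[of w] s2(3)[of "Suc (Suc w)"] Suc.prems by (auto simp: s1_def)
  ultimately obtain s' where "exec (While (Suc w) (Suc (Suc w)) (Seq (Assign w 1 w 1) c)) s2 s'"
    "s' w = n" "\<forall>i<w. s' i = s2 i"
    using Suc.IH[of s2 "Suc m"] Suc.prems y s2(2) by (auto simp del: map_eq_conv)
  then show ?case using ex eq ne by (metis exec.While_step)
qed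

text \<open>The target \<open>t\<close> may be an argument register, so intermediate results are
  kept in registers from \<open>w\<close> on and \<open>t\<close> is written last.\<close>

lemma compile:
  assumes "\<And>r. r \<in> set rs \<Longrightarrow> r < w" "t < w"
  shows "\<exists>c. implements c f rs t w"
  using assms
proof (induction f arbitrary: rs t w)
  case Zero
  show ?case
    unfolding implements_def
  proof (intro exI[of _ "Assign t 0 0 0"] allI impI)
    fix s y assume "computes Zero (map s rs) y"
    then have "y = 0" by (auto elim: computes_ZeroE)
    then show "\<exists>s'. exec (Assign t 0 0 0) s s' \<and> s' t = y \<and> (\<forall>i<w. i \<noteq> t \<longrightarrow> s' i = s i)"
      using exec.Assign[of t 0 0 0 s] by (intro exI[of _ "s(t := 0)"]) auto
  qed
next
  case Succ
  show ?case
    unfolding implements_def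
  proof (intro exI[of _ "Assign t 1 (hd rs) 1"] allI impI)
    fix s y assume "computes Succ (map s rs) y"
    then have "y = Suc (s (hd rs))" by (auto elim!: computes_SuccE)
    then show "\<exists>s'. exec (Assign t 1 (hd rs) 1) s s' \<and> s' t = y \<and> (\<forall>i<w. i \<noteq> t \<longrightarrow> s' i = s i)"
      using exec.Assign[of t 1 "hd rs" 1 s] by (intro exI[of _ "s(t := y)"]) auto
  qed
next
  case (Proj k)
  show ?case
    unfolding implements_def
  proof (intro exI[of _ "Assign t 1 (rs ! k) 0"] allI impI)
    fix s y assume "computes (Proj k) (map s rs) y"
    then have "y = s (rs ! k)" by (auto elim!: computes_ProjE)
    then show "\<exists>s'. exec (Assign t 1 (rs ! k) 0) s s' \<and> s' t = y \<and> (\<forall>i<w. i \<noteq> t \<longrightarrow> s' i = s i)"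
      using exec.Assign[of t 1 "rs ! k" 0 s] by (intro exI[of _ "s(t := y)"]) auto
  qed
next
  case (Comp f gs)
  let ?k = "length gs"
  have "\<exists>c. implements c (gs ! i) rs (w + i) (w + ?k)" if "i < ?k" for i
    by (rule Comp.IH(2)) (use that Comp.prems(1) in \<open>auto intro: trans_less_add1\<close>)
  then obtain C where "\<And>i. i < ?k \<Longrightarrow> implements (C i) (gs ! i) rs (w + i) (w + ?k)" by metis
  from compile_all[OF this order.refl Comp.prems(1)] obtain c where
    c: "\<And>s ys. (\<forall>i<?k. computes (gs ! i) (map s rs) (ys ! i)) \<Longrightarrow>
    \<exists>s'. exec c s s' \<and> (\<forall>i<?k. s' (w + i) = ys ! i) \<and> (\<forall>i<w. s' i = s i)" by auto
  obtain d where d: "implements d f [w..<w + ?k] t (w + ?k)"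
    using Comp.IH(1)[of "[w..<w + ?k]" "w + ?k" t] Comp.prems(2) by auto
  show ?case
    unfolding implements_def
  proof (intro exI[of _ "Seq c d"] allI impI)
    fix s y assume "computes (Comp f gs) (map s rs) y"
    then obtain ys where ys: "length ys = ?k" "\<forall>i<?k. computes (gs ! i) (map s rs) (ys ! i)"
      "computes f ys y" by (metis computes_CompE)
    from c[OF ys(2)] obtain s1 where s1: "exec c s s1" "\<forall>i<?k. s1 (w + i) = ys ! i" "\<forall>i<w. s1 i = s i"
      by blast
    have "map s1 [w..<w + ?k] = ys" by (rule nth_equalityI) (use ys(1) s1(2) in auto)
    with ys(3) obtain s2 where "exec d s1 s2" "s2 t = y" "\<And>i. i < w + ?k \<Longrightarrow> i \<noteq> t \<Longrightarrow> s2 i = s1 i"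
      using implementsD[OF d] by metis
    with s1 show "\<exists>s'. exec (Seq c d) s s' \<and> s' t = y \<and> (\<forall>i<w. i \<noteq> t \<longrightarrow> s' i = s i)"
      by (intro exI[of _ s2]) (auto intro: exec.Seq)
  qed
next
  case (Prec f g)
  let ?w = "Suc w" and ?v = "Suc (Suc w)"
  \<comment> \<open>The head of \<open>rs\<close> holds the number of rounds, the tail the
    parameters; for empty \<open>rs\<close> there is no value to compute.\<close>
  obtain c where c: "implements c f (tl rs) ?w (w + 3)"
    using Prec.IH(1)[of "tl rs" "w + 3" ?w] Prec.prems(1)
    by (metis list.set_sel(2) list.sel(2) trans_less_add1 add_Suc_right lessI less_SucI numeral_3_eq_3 add_0_right)
  have *: "r < w" if "r \<in> set (tl rs)" for r
    using that Prec.prems(1) by (metis list.set_sel(2) list.sel(2))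
  obtain d where d: "implements d g (w # ?w # tl rs) ?v (w + 3)"
    using Prec.IH(2)[of "w # ?w # tl rs" "w + 3" ?v] * by fastforce
  let ?l = "While w (hd rs) (Seq d (Seq (Assign ?w 1 ?v 0) (Assign w 1 w 1)))"
  show ?case
    unfolding implements_def
  proof (intro exI[of _ "Seq c (Seq (Assign w 0 0 0) (Seq ?l (Assign t 1 ?w 0)))"] allI impI)
    fix s y assume y: "computes (Prec f g) (map s rs) y"
    then obtain r rs' where rs: "rs = r # rs'" by (cases rs) (auto elim: computes_PrecE)
    let ?n = "s r"
    have y: "computes (Prec f g) (?n # map s rs') y" using y rs by simp
    obtain z where z: "computes f (map s rs') z"
      using computes_Prec_lower[OF y, of 0] by (auto elim: computes_Prec_0E)
    then obtain s1 where s1: "exec c s s1" "s1 ?w = z" "\<And>i. i < w + 3 \<Longrightarrow> i \<noteq> ?w \<Longrightarrow> s1 i = s i"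
      using implementsD[OF c] rs by auto
    define s2 where "s2 = s1(w := 0)"
    have s2: "exec (Assign w 0 0 0) s1 s2" "\<And>i. i < w \<Longrightarrow> s2 i = s i"
      using exec.Assign[of w 0 0 0 s1] s1(3) by (auto simp: s2_def)
    have m: "map s2 rs' = map s rs'" using s2(2) * rs by auto
    have "r < w" using Prec.prems rs by simp
    then obtain s3 where s3: "exec ?l s2 s3" "s3 ?w = y" "\<forall>i<w. s3 i = s2 i"
      using compile_Prec_loop[OF d, of r f ?n s2 y 0 z ?n] * rs y z m s2(2)[of r] s1(2)
      by (auto simp: s2_def intro: computes.Prec_0 simp del: map_eq_conv)
    have "exec (Assign t 1 ?w 0) s3 (s3(t := y))" using exec.Assign[of t 1 ?w 0 s3] s3(2) by simp
    then have "exec (Seq c (Seq (Assign w 0 0 0) (Seq ?l (Assign t 1 ?w 0)))) s (s3(t := y))"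
      using s1(1) s2(1) s3(1) by (blast intro: exec.Seq)
    then show "\<exists>s'. exec (Seq c (Seq (Assign w 0 0 0) (Seq ?l (Assign t 1 ?w 0)))) s s' \<and> s' t = y \<and>
        (\<forall>i<w. i \<noteq> t \<longrightarrow> s' i = s i)"
      using s3(3) s2(2) by (intro exI[of _ "s3(t := y)"]) auto
  qed
next
  case (Mu f)
  let ?w = "Suc w" and ?v = "Suc (Suc w)"
  obtain c where c: "implements c f (w # rs) ?w (w + 3)"
    using Mu.IH(1)[of "w # rs" "w + 3" ?w] Mu.prems(1) by fastforce
  let ?l = "While ?w ?v (Seq (Assign w 1 w 1) c)"
  show ?case
    unfolding implements_def
  proof (intro exI[of _ "Seq (Assign w 0 0 0) (Seq c (Seq (Assign ?v 0 0 0) (Seq ?l (Assign t 1 w 0))))"] allI impI)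
    fix s n assume n: "computes (Mu f) (map s rs) n"
    \<comment> \<open>The loop is entered with the value of \<open>f\<close> at 0, which exists
      whether or not the search stops there.\<close>
    have "\<exists>y. computes f (0 # map s rs) y"
    proof (rule computes_MuE[OF n])
      show "\<exists>y. computes f (0 # map s rs) y"
        if "\<And>i. i < n \<Longrightarrow> \<exists>y>0. computes f (i # map s rs) y" "computes f (n # map s rs) 0"
        using that(1)[of 0] that(2) by (cases "n = 0") auto
    qed
    then obtain y where y: "computes f (0 # map s rs) y" ..
    define s1 where "s1 = s(w := 0)"
    have s1: "exec (Assign w 0 0 0) s s1" using exec.Assign[of w 0 0 0 s] by (simp add: s1_def)
    have "map s1 rs = map s rs" using Mu.prems(1) by (auto simp: s1_def)
    moreover have "s1 w = 0" by (simp add: s1_def)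
    ultimately have "computes f (map s1 (w # rs)) y" using y by (simp only: list.map)
    then obtain s2 where s2: "exec c s1 s2" "s2 ?w = y" "\<And>i. i < w + 3 \<Longrightarrow> i \<noteq> ?w \<Longrightarrow> s2 i = s1 i"
      using implementsD[OF c] by auto
    define s3 where "s3 = s2(?v := 0)"
    have s3: "exec (Assign ?v 0 0 0) s2 s3" "\<And>i. i < w \<Longrightarrow> s3 i = s i"
      using exec.Assign[of ?v 0 0 0 s2] s2(3) by (auto simp: s3_def s1_def)
    have "map s3 rs = map s rs" using s3(2) Mu.prems(1) by auto
    moreover have "s3 w = 0" "s3 ?w = y" "s3 ?v = 0"
      using s2(3)[of w] s2(2) by (auto simp: s3_def s1_def)
    ultimately obtain s4 where s4: "exec ?l s3 s4" "s4 w = n" "\<forall>i<w. s4 i = s3 i"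
      using compile_Mu_loop[OF c Mu.prems(1), of s3 n 0 n] n y by (auto simp del: map_eq_conv)
    have "exec (Assign t 1 w 0) s4 (s4(t := n))" using exec.Assign[of t 1 w 0 s4] s4(2) by simp
    then have "exec (Seq (Assign w 0 0 0) (Seq c (Seq (Assign ?v 0 0 0) (Seq ?l (Assign t 1 w 0))))) s (s4(t := n))"
      using s1(1) s2(1) s3(1) s4(1) by (blast intro: exec.Seq)
    then show "\<exists>s'. exec (Seq (Assign w 0 0 0) (Seq c (Seq (Assign ?v 0 0 0) (Seq ?l (Assign t 1 w 0))))) s s' \<and>
        s' t = n \<and> (\<forall>i<w. i \<noteq> t \<longrightarrow> s' i = s i)"
      using s4(3) s3(2) by (intro exI[of _ "s4(t := n)"]) auto
  qed
qed

text \<open>The registers 0 and 1 for the input and 2 for the output will become the unknowns 7, 8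
  and 9.\<close>

lemma compile_program:
  "\<exists>c. \<forall>s y. computes f [s 0, s 1] y \<longrightarrow> (\<exists>n s'. (step ^^ n) (c, s) = (Skip, s') \<and> s' 2 = y)"
proof -
  obtain c where "implements c f [0, 1] 2 3"
    using compile[where rs = "[0, 1]" and w = 3 and t = 2 and f = f] by fastforce
  then show ?thesis
    unfolding implements_def using exec_steps by (intro exI[of _ c]) fastforce
qed

section \<open>Systems of conditional equations\<close>

lemma M_polys_mult:
  assumes K0: "is_subfield K0" and p: "p \<in> M_polys K0 n" and q: "q \<in> M_polys K0 n"
  shows "p * q \<in> M_polys K0 n"
proof -
  have zero: "0 \<in> M_polys K0 n" by (simp add: M_polys_def)
  have sum: "(\<Sum>t\<in>A. f t) \<in> M_polys K0 n" if "\<And>t. t \<in> A \<Longrightarrow> f t \<in> M_polys K0 n"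
    for A and f :: "'c \<Rightarrow> ('b, 'a) mpoly"
    using that by (induction A rule: infinite_finite_induct) (auto simp: zero M_polys_add[OF K0])
  have "p * q = (\<Sum>s\<in>keys p. \<Sum>t\<in>keys q. Poly_Mapping.single (s + t) (lookup p s * lookup q t))"
    by (subst (1) poly_mapping_eq_sum_single[of p], subst (1) poly_mapping_eq_sum_single[of q])
       (simp only: sum_product mult_single)
  moreover have "Poly_Mapping.single (s + t) (lookup p s * lookup q t) \<in> M_polys K0 n"
    if "s \<in> keys p" "t \<in> keys q" for s t
  proof (rule single_in_M_polys[OF K0])
    show "lookup p s * lookup q t \<in> K0"
      using that p q K0 by (auto simp: M_polys_def is_subfield_def)
    show "fst v < n" if "v \<in> keys (s + t)" for v
      using that \<open>s \<in> keys p\<close> \<open>t \<in> keys q\<close> p q Poly_Mapping.keys_add[of s t]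
      unfolding M_polys_def by blast
  qed
  ultimately show ?thesis by (simp add: sum)
qed

lemma M_polys_mono: "p \<in> M_polys K0 m \<Longrightarrow> m \<le> n \<Longrightarrow> p \<in> M_polys K0 n"
  unfolding M_polys_def using order.strict_trans2 by blast

lemma of_nat_in_subfield: "is_subfield K0 \<Longrightarrow> of_nat n \<in> K0"
  by (induction n) (auto simp: is_subfield_def)

lemma const_of_nat_in_M_polys: "is_subfield K0 \<Longrightarrow> const (of_nat a) \<in> M_polys K0 n"
  by (rule const_in_M_polys) (auto intro: of_nat_in_subfield)

lemma const_minus_1_in_M_polys: "is_subfield K0 \<Longrightarrow> const (- 1) \<in> M_polys K0 n"
  by (rule const_in_M_polys) (auto simp: is_subfield_def)

lemma eval_mpoly_const [simp]: "eval_mpoly x (const a) l = a"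
  by (simp add: const_def)

lemma eval_mpoly_indet [simp]: "eval_mpoly x (indet i m) l = x i (l + m)"
  by (simp add: indet_def)

lemma eval_mpoly_cong:
  assumes "p \<in> M_polys K0 n" "\<And>i. i < n \<Longrightarrow> x i = y i"
  shows "eval_mpoly x p l = eval_mpoly y p l"
  unfolding eval_mpoly_def eval_mon_def
  using assms by (intro sum.cong prod.cong refl arg_cong2[of _ _ _ _ "(*)"]) (auto simp: M_polys_def)

type_synonym ('m, 'k) clause = "('m, 'k) mpoly \<times> ('m, 'k) mpoly \<times> ('m, 'k) mpoly"

definition holds :: "(nat \<Rightarrow> 'm::comm_monoid_add \<Rightarrow> 'k::field) \<Rightarrow> ('m, 'k) clause \<Rightarrow> bool" where
  "holds x C \<longleftrightarrow> (case C of (p, q, r) \<Rightarrow>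
     \<forall>l. eval_mpoly x p l = 0 \<longrightarrow> eval_mpoly x q l = 0 \<longrightarrow> eval_mpoly x r l = 0)"

text \<open>
  The clause \<open>p = 0 \<and> q = 0 \<longrightarrow> r = 0\<close> means that \<open>r\<close> is pointwise of the form \<open>u * p + v * q\<close>; the
  multipliers are further unknowns. The factor \<open>X\<^sub>0\<close>, which is nonzero in the intended solutions,
  makes all the polynomials vanish at the zero sequences.
\<close>

definition clause_poly :: "nat \<Rightarrow> ('m::comm_monoid_add, 'k::field) clause \<Rightarrow> ('m, 'k) mpoly" where
  "clause_poly i C = (case C of (p, q, r) \<Rightarrow>
     indet 0 0 * r + (indet i 0 * p + indet (Suc i) 0 * q))"

text \<open>Where \<open>p\<close> or \<open>q\<close> is nonzero, one multiplier is found by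
  division; where \<open>r\<close> vanishes, both can be 0. Conversely, where \<open>p\<close> and
  \<open>q\<close> vanish, the equation reduces to \<open>x 0 l * r = 0\<close> with
  \<open>x 0 l\<close> nonzero.\<close>

lemma solvable_clause_polys:
  fixes x :: "nat \<Rightarrow> 'm::comm_monoid_add \<Rightarrow> 'k::field"
  assumes K0: "is_subfield K0" and N: "0 < N"
    and cls: "\<And>p q r. (p, q, r) \<in> set cls \<Longrightarrow> {p, q, r} \<subseteq> M_polys K0 N"
    and x: "\<And>l. x 0 l \<noteq> 0"
  shows "(\<forall>C\<in>set cls. holds x C) \<longleftrightarrow>
    (\<exists>y. (\<forall>i<N. y i = x i) \<and> (\<forall>j<length cls. eval_mpoly y (clause_poly (N + 2 * j) (cls ! j)) = 0))"
proof (intro iffI ballI)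
  fix C assume "\<exists>y. (\<forall>i<N. y i = x i) \<and>
    (\<forall>j<length cls. eval_mpoly y (clause_poly (N + 2 * j) (cls ! j)) = 0)" and C: "C \<in> set cls"
  then obtain y where y: "\<And>i. i < N \<Longrightarrow> y i = x i"
    "\<And>j. j < length cls \<Longrightarrow> eval_mpoly y (clause_poly (N + 2 * j) (cls ! j)) = 0" by blast
  obtain j where j: "j < length cls" "cls ! j = C" using C by (auto simp: in_set_conv_nth)
  obtain p q r where pqr: "C = (p, q, r)" by (cases C)
  have eq: "eval_mpoly y p l = eval_mpoly x p l" "eval_mpoly y q l = eval_mpoly x q l"
    "eval_mpoly y r l = eval_mpoly x r l" for l
    using cls[of p q r] C pqr y(1) by (auto intro!: eval_mpoly_cong[of _ K0 N])
  have "eval_mpoly y (clause_poly (N + 2 * j) (cls ! j)) l = 0" for l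
    using y(2)[OF j(1)] by simp
  then have "x 0 l * eval_mpoly x r l + (y (N + 2 * j) l * eval_mpoly x p l +
      y (Suc (N + 2 * j)) l * eval_mpoly x q l) = 0" for l
    using y(1)[OF N] unfolding j(2) pqr
    by (simp add: clause_poly_def eval_mpoly_add eval_mpoly_mult eq)
  then have "eval_mpoly x r l = 0" if "eval_mpoly x p l = 0" "eval_mpoly x q l = 0" for l
    using that x[of l] by (metis add_0_right mult_eq_0_iff mult_zero_right)
  then show "holds x C"
    unfolding holds_def pqr by simp
next
  assume h: "\<forall>C\<in>set cls. holds x C"
  have "\<exists>u v. x 0 l * eval_mpoly x r l + (u * eval_mpoly x p l + v * eval_mpoly x q l) = 0"
    if mem: "(p, q, r) \<in> set cls" for p q r l
  proof -
    consider "eval_mpoly x p l \<noteq> 0" | "eval_mpoly x q l \<noteq> 0" | "eval_mpoly x r l = 0"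
      using bspec[OF h mem] unfolding holds_def by auto
    then show ?thesis
    proof cases
      case 1
      then show ?thesis
        by (intro exI[of _ "- x 0 l * eval_mpoly x r l / eval_mpoly x p l"] exI[of _ 0]) simp
    next
      case 2
      then show ?thesis
        by (intro exI[of _ "- x 0 l * eval_mpoly x r l / eval_mpoly x q l"] exI[of _ 0]) simp
    next
      case 3
      then show ?thesis by (intro exI[of _ 0]) simp
    qed
  qed
  then have "\<exists>u v. x 0 l * eval_mpoly x (snd (snd (cls ! j))) l + (u * eval_mpoly x (fst (cls ! j)) l +
      v * eval_mpoly x (fst (snd (cls ! j))) l) = 0" if "j < length cls" for j l
    using nth_mem[OF that] by simp
  then obtain u v where uv: "\<And>j l. j < length cls \<Longrightarrow> x 0 l * eval_mpoly x (snd (snd (cls ! j))) l +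
     (u j l * eval_mpoly x (fst (cls ! j)) l + v j l * eval_mpoly x (fst (snd (cls ! j))) l) = 0"
    by metis
  \<comment> \<open>Clause \<open>j\<close> owns the two unknowns \<open>N + 2 * j\<close> and
    \<open>N + 2 * j + 1\<close>.\<close>
  define y where "y = (\<lambda>i. if i < N then x i else if even (i - N) then u ((i - N) div 2) else v ((i - N) div 2))"
  have "eval_mpoly y (clause_poly (N + 2 * j) (cls ! j)) = 0" if j: "j < length cls" for j
  proof
    fix l
    obtain p q r where pqr: "cls ! j = (p, q, r)" by (cases "cls ! j")
    have eq: "eval_mpoly y p l = eval_mpoly x p l" "eval_mpoly y q l = eval_mpoly x q l"
      "eval_mpoly y r l = eval_mpoly x r l"
      using cls[of p q r] j pqr nth_mem[OF j]
      by (auto intro!: eval_mpoly_cong[of _ K0 N] simp: y_def)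
    have "y 0 = x 0" "y (N + 2 * j) = u j" "y (Suc (N + 2 * j)) = v j"
      using N by (auto simp: y_def Suc_diff_le)
    then show "eval_mpoly y (clause_poly (N + 2 * j) (cls ! j)) l = 0 l"
      using uv[OF j, of l] unfolding pqr
      by (simp add: clause_poly_def eval_mpoly_add eval_mpoly_mult eq)
  qed
  then show "\<exists>y. (\<forall>i<N. y i = x i) \<and> (\<forall>j<length cls. eval_mpoly y (clause_poly (N + 2 * j) (cls ! j)) = 0)"
    by (intro exI[of _ y]) (auto simp: y_def)
qed

lemma clause_poly_in_M_polys:
  assumes "is_subfield K0" "{p, q, r} \<subseteq> M_polys K0 N" "N \<le> i" "Suc i < n"
  shows "clause_poly i (p, q, r) \<in> M_polys K0 n"
  using assms unfolding clause_poly_def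
  by (auto intro!: M_polys_add M_polys_mult indet_in_M_polys intro: M_polys_mono)

text \<open>This tells clause polynomials apart from input polynomials, whose value at the zero
  sequences is a positive integer.\<close>

lemma eval_mpoly_clause_poly_zero: "eval_mpoly (\<lambda>_ _. 0) (clause_poly i C) l = 0"
  by (cases C) (simp add: clause_poly_def eval_mpoly_add eval_mpoly_mult)

section \<open>Injectivity of the coding\<close>

text \<open>\<open>set_encode\<close> is injective on finite sets, so equal codes give equal graphs.
  Injectivity is asked only where values occur, since \<open>c\<close> is injective only on
  \<open>K0\<close>.\<close>

lemma encode_pm_inj:
  assumes "encode_pm ea eb p = encode_pm ea eb q"
    and ea: "inj_on ea (keys p \<union> keys q)" and eb: "inj_on eb (lookup p ` keys p \<union> lookup q ` keys q)"
  shows "p = q"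
proof -
  let ?f = "\<lambda>p a. prod_encode (ea a, eb (lookup p a))"
  have eq: "?f p ` keys p = ?f q ` keys q"
    using assms(1) unfolding encode_pm_def by (simp add: set_encode_eq)
  have *: "a \<in> keys q' \<and> lookup p' a = lookup q' a"
    if sub: "?f p' ` keys p' \<subseteq> ?f q' ` keys q'" and a: "a \<in> keys p'"
      and inj: "inj_on ea (keys p' \<union> keys q')" "inj_on eb (lookup p' ` keys p' \<union> lookup q' ` keys q')" for p' q' a
  proof -
    obtain b where b: "b \<in> keys q'" "ea a = ea b" "eb (lookup p' a) = eb (lookup q' b)"
      using sub a by auto
    then have "a = b" using a inj(1) by (auto dest: inj_onD)
    then show ?thesis using a inj(2) b by (auto dest: inj_onD)
  qed
  show ?thesis
  proof (rule poly_mapping_eqI)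
    fix a
    have "a \<in> keys p \<Longrightarrow> lookup p a = lookup q a"
      by (rule *[THEN conjunct2]) (simp_all only: eq ea eb order.refl)
    moreover have "a \<in> keys q \<Longrightarrow> lookup q a = lookup p a"
      by (rule *[THEN conjunct2]) (simp_all only: eq ea eb order.refl Un_commute)
    ultimately show "lookup p a = lookup q a"
      by (metis in_keys_iff)
  qed
qed

lemma inj_encode_mon:
  assumes "inj em" shows "inj (encode_mon em)"
proof (rule injI)
  fix s t assume "encode_mon em s = encode_mon em t"
  then show "s = t"
    unfolding encode_mon_def
    by (rule encode_pm_inj) (use assms in \<open>auto intro!: inj_onI dest: injD\<close>)
qed

lemma inj_on_encode_mpoly:
  assumes "inj em" "inj_on c K0"
  shows "inj_on (encode_mpoly em c) (M_polys K0 n)"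
proof (rule inj_onI)
  fix p q :: "('a, 'b) mpoly"
  assume "p \<in> M_polys K0 n" "q \<in> M_polys K0 n" and eq: "encode_mpoly em c p = encode_mpoly em c q"
  then have sub: "lookup p ` keys p \<union> lookup q ` keys q \<subseteq> K0" by (auto simp: M_polys_def)
  show "p = q"
    by (rule encode_pm_inj[OF eq[unfolded encode_mpoly_def]])
      (rule inj_on_subset[OF inj_encode_mon[OF assms(1)] subset_UNIV],
        rule inj_on_subset[OF assms(2) sub])
qed

text \<open>With \<open>Suc a\<close> the constant term is nonzero even for \<open>a = 0\<close>:
  there are always exactly two monomials, and unknown 0 vanishes nowhere in a solution.\<close>

definition input_poly :: "nat \<Rightarrow> nat \<Rightarrow> ('m::comm_monoid_add, 'k::field) mpoly" where
  "input_poly i a = indet i 0 + const (of_nat (Suc a))"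

text \<open>Each of the two monomials contributes one power of 2. The code \<open>\<kappa>\<close>
  of the indeterminate does not depend on \<open>a\<close>, which makes the whole code computable
  from \<open>a\<close>.\<close>

lemma encode_input_poly:
  assumes "inj em"
  shows "\<exists>\<kappa>. \<forall>a. encode_mpoly em c (input_poly i a :: ('m::comm_monoid_add, 'k::field_char_0) mpoly) =
    2 ^ prod_encode (\<kappa>, c 1) + 2 ^ prod_encode (0, c (of_nat (Suc a)))"
proof (intro exI allI)
  fix a
  let ?t = "Poly_Mapping.single (i, 0 :: 'm) (1 :: nat)"
  let ?p = "input_poly i a :: ('m, 'k) mpoly"
  have t: "?t \<noteq> 0" by (simp flip: keys_eq_empty)
  define b where "b = (of_nat (Suc a) :: 'k)"
  have b: "b \<noteq> 0" unfolding b_def by (rule of_nat_neq_0)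
  have lookup: "lookup ?p s = (if s = ?t then 1 else if s = 0 then b else 0)" for s
    using t unfolding input_poly_def indet_def const_def b_def[symmetric]
    by (auto simp: lookup_add lookup_single when_def)
  have keys: "keys ?p = {?t, 0}"
    using t b by (auto simp: in_keys_iff lookup split: if_splits)
  have mon0: "encode_mon em 0 = 0" by (simp add: encode_mon_def encode_pm_def)
  then have "encode_mon em ?t \<noteq> 0" using t inj_encode_mon[OF assms] by (metis injD)
  then show "encode_mpoly em c ?p =
      2 ^ prod_encode (encode_mon em ?t, c 1) + 2 ^ prod_encode (0, c (of_nat (Suc a)))"
    unfolding encode_mpoly_def encode_pm_def keys
    using t by (simp add: lookup mon0 set_encode_def flip: b_def del: of_nat_Suc)
qed

section \<open>The system simulating a program\<close>

definition diff :: "('m::comm_monoid_add, 'k::field) mpoly \<Rightarrow> ('m, 'k) mpoly \<Rightarrow> ('m, 'k) mpoly" where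
  "diff p q = p + const (- 1) * q"

lemma eval_mpoly_diff [simp]: "eval_mpoly x (diff p q) l = eval_mpoly x p l - eval_mpoly x q l"
  by (simp add: diff_def eval_mpoly_add eval_mpoly_mult)

definition nat_const :: "nat \<Rightarrow> ('m::comm_monoid_add, 'k::field) mpoly" where
  "nat_const a = const (of_nat a)"

lemma eval_mpoly_nat_const [simp]: "eval_mpoly x (nat_const a) l = of_nat a"
  by (simp add: nat_const_def)

lemma nat_const_in_M_polys: "is_subfield K0 \<Longrightarrow> nat_const a \<in> M_polys K0 n"
  unfolding nat_const_def by (rule const_in_M_polys) (auto intro: of_nat_in_subfield)

text \<open>
  The unknown \<open>v\<close> labels the columns, \<open>w\<close> the rows, where rows run in direction \<open>e\<close>. In a row
  labelled \<open>L\<close>, the unknown \<open>d\<close> counts modulo \<open>4 * L\<close>; it is synchronised with the columns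
  labelled \<open>L\<close> and forces columns labelled \<open>2 * L\<close>.
\<close>

definition row_clauses :: "'m::comm_monoid_add \<Rightarrow> 'm \<Rightarrow> nat \<Rightarrow> nat \<Rightarrow> nat \<Rightarrow> ('m, 'k::field) clause list" where
  "row_clauses e f v w d =
    (let V = indet v 0; W = indet w 0; D = indet d 0 in
     [(0, 0, diff (indet v f) V),
      (0, 0, diff V (nat_const 1) * diff (indet v e) (nat_const 1)),
      (diff V W, 0, D * diff D (nat_const 2 * W)),
      (diff D W, 0, diff V (nat_const 2 * W)),
      (diff (D + nat_const 1) (nat_const 4 * W), 0, indet d e),
      (0, 0, diff (D + nat_const 1) (nat_const 4 * W) * diff (indet d e) (D + nat_const 1))])"

text \<open>In a field a disjunction of equations is the vanishing of a product; the
  \<open>if\<close> is split into a conditional equation and such a disjunction.\<close>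

lemma holds_row_clauses:
  "(\<forall>C\<in>set (row_clauses e f v w d). holds x C) \<longleftrightarrow>
   (\<forall>l. x v (l + f) = x v l \<and> (x v l = 1 \<or> x v (l + e) = 1) \<and>
     (x v l = x w l \<longrightarrow> x d l = 0 \<or> x d l = 2 * x w l) \<and>
     (x d l = x w l \<longrightarrow> x v l = 2 * x w l) \<and>
     x d (l + e) = (if x d l + 1 = 4 * x w l then 0 else x d l + 1))"
  by (simp add: row_clauses_def holds_def Let_def eval_mpoly_add eval_mpoly_mult) auto

text \<open>
  The unknowns are: \<open>0\<close> and \<open>1\<close> for the inputs, \<open>2\<close> and \<open>3\<close> for the labels of columns and rows,
  \<open>4\<close> and \<open>5\<close> for the counters in rows and columns, \<open>6\<close> for the program, and \<open>7 + u\<close> for the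
  register \<open>u\<close>. The input \<open>a\<close> is represented by the constant sequence \<open>- a - 1\<close>.
\<close>

definition init_clauses :: "nat \<Rightarrow> com \<Rightarrow> ('m::comm_monoid_add, 'k::field) clause list" where
  "init_clauses N c0 = (let D = indet 4 0 in
     [(D, 0, diff (indet 6 0) (nat_const (to_nat c0))),
      (D, 0, indet 7 0 + (indet 0 0 + nat_const 1)),
      (D, 0, indet 8 0 + (indet 1 0 + nat_const 1))] @
     map (\<lambda>u. (D, 0, indet (7 + u) 0)) [2..<N])"

lemma holds_init_clauses:
  "(\<forall>C\<in>set (init_clauses N c0). holds x C) \<longleftrightarrow>
   (\<forall>l. x 4 l = 0 \<longrightarrow> x 6 l = of_nat (to_nat c0) \<and> x 7 l + (x 0 l + 1) = 0 \<and>
     x 8 l + (x 1 l + 1) = 0 \<and> (\<forall>u\<in>{2..<N}. x (7 + u) l = 0))"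
  by (simp add: init_clauses_def holds_def Let_def eval_mpoly_add eval_mpoly_mult) blast

text \<open>Unknown 9 is the output register, so a halted run must have returned 0.\<close>

definition final_clause :: "('m::comm_monoid_add, 'k::field) clause" where
  "final_clause = (diff (indet 6 0) (nat_const (to_nat Skip)), 0, indet 9 0)"

lemma holds_final_clause:
  "holds x final_clause \<longleftrightarrow> (\<forall>l. x 6 l = of_nat (to_nat Skip) \<longrightarrow> x 9 l = 0)"
  by (simp add: final_clause_def holds_def)

text \<open>The factor \<open>D\<close>, the counter at the next point, switches the transition off
  where the computation restarts. For unequal registers, their difference is a factor in place of a
  premise.\<close>

definition step_clauses :: "'m::comm_monoid_add \<Rightarrow> nat \<Rightarrow> com \<Rightarrow> ('m, 'k::field) clause list" where
  "step_clauses e N c = (case instr c of (r, q, c', c'', t, a, p, b) \<Rightarrow>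
    (let D = indet 4 e; P = indet 6 0; P' = indet 6 e; R = (\<lambda>u. indet (7 + u) 0); H = diff P (nat_const (to_nat c)) in
     [(H, diff (R r) (R q), D * diff P' (nat_const (to_nat c'))),
      (H, 0, diff (R r) (R q) * (D * diff P' (nat_const (to_nat c''))))] @
     map (\<lambda>u. (H, 0, D * diff (indet (7 + u) e) (if u = t then nat_const a * R p + nat_const b else R u))) [0..<N]))"

lemma holds_step_clauses:
  assumes "instr c = (r, q, c', c'', t, a, p, b)"
  shows "(\<forall>C\<in>set (step_clauses e N c). holds x C) \<longleftrightarrow>
   (\<forall>l. x 6 l = of_nat (to_nat c) \<longrightarrow> x 4 (l + e) \<noteq> 0 \<longrightarrow>
     x 6 (l + e) = (if x (7 + r) l = x (7 + q) l then of_nat (to_nat c') else of_nat (to_nat c'')) \<and>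
     (\<forall>u<N. x (7 + u) (l + e) = (if u = t then of_nat a * x (7 + p) l + of_nat b else x (7 + u) l)))"
proof -
  have if_eval: "eval_mpoly x (if Q then f else g) l = (if Q then eval_mpoly x f l else eval_mpoly x g l)"
    for Q f g l by simp
  show ?thesis
    unfolding step_clauses_def assms
    by (simp add: holds_def Let_def eval_mpoly_add eval_mpoly_mult if_eval) auto
qed

definition represents :: "nat \<Rightarrow> (nat \<Rightarrow> 'm \<Rightarrow> 'k::field_char_0) \<Rightarrow> 'm \<Rightarrow> com \<times> (nat \<Rightarrow> nat) \<Rightarrow> bool" where
  "represents N x l cs \<longleftrightarrow> x 6 l = of_nat (to_nat (fst cs)) \<and> (\<forall>u<N. x (7 + u) l = of_nat (snd cs u))"

text \<open>The registers that a step reads must be represented; a write beyond \<open>N\<close>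
  changes nothing that is.\<close>

definition registers_below :: "nat \<Rightarrow> com \<Rightarrow> bool" where
  "registers_below N c \<longleftrightarrow> (case instr c of (r, q, c', c'', t, a, p, b) \<Rightarrow> r < N \<and> q < N \<and> p < N)"

text \<open>In characteristic zero two registers agree as field elements iff they agree as numbers,
  so the branch taken is the same. The right-hand side is the conclusion of the step
  clauses.\<close>

lemma represents_step:
  assumes "represents N x l (c, s)" "registers_below N c" "instr c = (r, q, c', c'', t, a, p, b)"
  shows "represents N x l' (step (c, s)) \<longleftrightarrow>
     x 6 l' = (if x (7 + r) l = x (7 + q) l then of_nat (to_nat c') else of_nat (to_nat c'')) \<and>
     (\<forall>u<N. x (7 + u) l' = (if u = t then of_nat a * x (7 + p) l + of_nat b else x (7 + u) l))"
proof -
  have "x (7 + r) l = of_nat (s r)" "x (7 + q) l = of_nat (s q)" "x (7 + p) l = of_nat (s p)"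
    "\<And>u. u < N \<Longrightarrow> x (7 + u) l = of_nat (s u)"
    using assms by (auto simp: represents_def registers_below_def)
  then show ?thesis
    using assms(3) by (auto simp: represents_def)
qed

text \<open>The second copy of the row clauses interchanges the directions and the two
  labellings.\<close>

definition system :: "'m::comm_monoid_add \<Rightarrow> 'm \<Rightarrow> nat \<Rightarrow> com \<Rightarrow> com list \<Rightarrow> ('m, 'k::field) clause list" where
  "system e f N c0 cs = row_clauses e f 2 3 4 @ row_clauses f e 3 2 5 @ init_clauses N c0 @
     [final_clause] @ concat (map (step_clauses e N) cs)"

lemma system_in_M_polys:
  assumes K0: "is_subfield K0" and N: "3 \<le> N" and cs: "\<And>c. c \<in> set cs \<Longrightarrow> registers_below N c"
    and C: "(p, q, r) \<in> set (system e f N c0 cs)"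
  shows "{p, q, r} \<subseteq> M_polys K0 (7 + N)"
proof -
  note intros = M_polys_add[OF K0] M_polys_mult[OF K0] indet_in_M_polys[OF K0]
    nat_const_in_M_polys[OF K0] const_minus_1_in_M_polys[OF K0]
  have zero: "0 \<in> M_polys K0 (7 + N)" by (simp add: M_polys_def)
  have diff: "diff g h \<in> M_polys K0 (7 + N)" if "g \<in> M_polys K0 (7 + N)" "h \<in> M_polys K0 (7 + N)"
    for g h :: "('b, 'a) mpoly"
    unfolding diff_def using that by (intro intros)
  have step: ?thesis if "(p, q, r) \<in> set (step_clauses e N c)" "registers_below N c" for c
    using that by (auto simp: step_clauses_def registers_below_def Let_def zero
      intro!: intros diff split: prod.splits)
  show ?thesis
    using C cs step N
    by (auto simp: system_def row_clauses_def init_clauses_def final_clause_def Let_def zero intro!: intros diff)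
qed

section \<open>Every grid contains long runs\<close>

text \<open>In characteristic zero no wrap occurs while the count stays below
  \<open>4 * L\<close>.\<close>

lemma counter_run:
  fixes d :: "nat \<Rightarrow> 'k::field_char_0"
  assumes d: "\<And>i. d (Suc i) = (if d i + 1 = 4 * of_nat L then 0 else d i + 1)"
  shows "d i = of_nat a \<Longrightarrow> a + t < 4 * L \<Longrightarrow> d (i + t) = of_nat (a + t)"
proof (induction t)
  case (Suc t)
  then have "d (i + t) = of_nat (a + t)" by simp
  moreover have "of_nat (Suc (a + t)) \<noteq> (of_nat (4 * L) :: 'k)"
    using Suc.prems(2) by (simp only: of_nat_eq_iff)
  ultimately show ?case using d[of "i + t"] by (simp add: add_ac)
qed auto

text \<open>At a label \<open>L\<close> the counter is 0 or \<open>2 * L\<close>; in the latter case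
  it reaches \<open>4 * L - 1\<close> after \<open>2 * L - 1\<close> steps and then wraps.\<close>

lemma counter_zero:
  fixes V d :: "nat \<Rightarrow> 'k::field_char_0"
  assumes d: "\<And>i. d (Suc i) = (if d i + 1 = 4 * of_nat L then 0 else d i + 1)"
    and V: "V i = of_nat L \<Longrightarrow> d i = 0 \<or> d i = 2 * of_nat L" "V i = of_nat L" and L: "0 < L"
  shows "\<exists>i. d i = 0"
proof (cases "d i = 0")
  case False
  then have "d i = of_nat (2 * L)" using V by simp
  then have "d (i + (2 * L - 1)) = of_nat (2 * L + (2 * L - 1))"
    using L by (intro counter_run[of d L, OF d]) auto
  also have "2 * L + (2 * L - 1) = 4 * L - 1" by simp
  finally have "d (i + (2 * L - 1)) + 1 = of_nat (4 * L - 1 + 1)" by (simp only: of_nat_add of_nat_1)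
  then have "d (i + (2 * L - 1)) + 1 = 4 * of_nat L" using L by simp
  then show ?thesis using d by metis
qed blast

text \<open>\<open>L\<close> steps after a zero the counter equals \<open>L\<close>, which forces
  the label \<open>2 * L\<close> there.\<close>

lemma row_forces_next_label:
  fixes V d :: "nat \<Rightarrow> 'k::field_char_0"
  assumes d: "\<And>i. d (Suc i) = (if d i + 1 = 4 * of_nat L then 0 else d i + 1)"
    and V: "\<And>i. V i = of_nat L \<Longrightarrow> d i = 0 \<or> d i = 2 * of_nat L"
      "\<And>i. d i = of_nat L \<Longrightarrow> V i = 2 * of_nat L"
    and L: "0 < L" and i: "V i = of_nat L"
  shows "\<exists>i. V i = of_nat (2 * L)"
proof -
  obtain i0 where "d i0 = of_nat 0" using counter_zero[of d L V i, OF d V(1) i L] by auto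
  then have "d (i0 + L) = of_nat (0 + L)" by (rule counter_run[of d L, OF d]) (use L in auto)
  then show ?thesis using V(2) by auto
qed

text \<open>\<open>V\<close> depends on \<open>i\<close> only and \<open>W\<close> on
  \<open>j\<close> only. A row labelled \<open>L\<close> crossing a column labelled \<open>L\<close>
  yields a column labelled \<open>2 * L\<close>, and symmetrically the column yields such a
  row.\<close>

lemma labels_unbounded:
  fixes V W d d' :: "nat \<Rightarrow> nat \<Rightarrow> 'k::field_char_0"
  assumes V: "\<And>i j. V i (Suc j) = V i j" "\<And>i j. V i j = 1 \<or> V (Suc i) j = 1"
      "\<And>i j. V i j = W i j \<Longrightarrow> d i j = 0 \<or> d i j = 2 * W i j" "\<And>i j. d i j = W i j \<Longrightarrow> V i j = 2 * W i j"
      "\<And>i j. d (Suc i) j = (if d i j + 1 = 4 * W i j then 0 else d i j + 1)"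
    and W: "\<And>i j. W (Suc i) j = W i j" "\<And>i j. W i j = 1 \<or> W i (Suc j) = 1"
      "\<And>i j. W i j = V i j \<Longrightarrow> d' i j = 0 \<or> d' i j = 2 * V i j" "\<And>i j. d' i j = V i j \<Longrightarrow> W i j = 2 * V i j"
      "\<And>i j. d' i (Suc j) = (if d' i j + 1 = 4 * V i j then 0 else d' i j + 1)"
  shows "\<exists>i j. V i j = 2 ^ n \<and> W i j = 2 ^ n"
proof -
  have Vj: "V i j = V i 0" for i j by (induction j) (auto simp: V(1))
  have Wi: "W i j = W 0 j" for i j by (induction i) (auto simp: W(1))
  show ?thesis
  proof (induction n)
    case 0
    obtain i where "V i 0 = 1" using V(2) by blast
    moreover obtain j where "W 0 j = 1" using W(2) by blast
    ultimately show ?case using Vj Wi by (metis power_0)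
  next
    case (Suc n)
    let ?L = "2 ^ n :: nat"
    from Suc obtain i j where "V i j = of_nat ?L" "W i j = of_nat ?L" by auto
    then have ij: "V i 0 = of_nat ?L" "\<And>i'. W i' j = of_nat ?L" "W 0 j = of_nat ?L" "\<And>j'. V i j' = of_nat ?L"
      using Vj Wi by metis+
    have "\<exists>i. V i 0 = of_nat (2 * ?L)"
      by (rule row_forces_next_label[of "\<lambda>i. d i j" ?L "\<lambda>i. V i 0" i])
         (use V(3-5)[of _ j] ij Vj in metis, use V(3-5)[of _ j] ij Vj in metis,
          use V(3-5)[of _ j] ij Vj in metis, simp, use ij in simp)
    moreover have "\<exists>j. W 0 j = of_nat (2 * ?L)"
      by (rule row_forces_next_label[of "\<lambda>j. d' i j" ?L "\<lambda>j. W 0 j" j])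
         (use W(3-5)[of i] ij Wi in metis, use W(3-5)[of i] ij Wi in metis,
          use W(3-5)[of i] ij Wi in metis, simp, use ij in simp)
    ultimately show ?case using Vj Wi by (metis of_nat_numeral of_nat_power power_Suc)
  qed
qed

section \<open>Simulation of the program along a row\<close>

definition input_store :: "nat \<Rightarrow> nat \<Rightarrow> nat \<Rightarrow> nat" where
  "input_store a b = (\<lambda>_. 0)(0 := a, 1 := b)"

lemma represents_init:
  assumes "\<forall>C\<in>set (init_clauses N c0). holds x C" "x 4 l = 0"
    and "x 0 l = - of_nat (Suc a)" "x 1 l = - of_nat (Suc b)"
  shows "represents N x l (c0, input_store a b)"
proof -
  have "x 6 l = of_nat (to_nat c0)" "x 7 l + (x 0 l + 1) = 0" "x 8 l + (x 1 l + 1) = 0"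
    and u: "\<And>u. u \<in> {2..<N} \<Longrightarrow> x (7 + u) l = 0"
    using assms(1,2) unfolding holds_init_clauses by auto
  moreover have "x (7 + u) l = of_nat (input_store a b u)" if "u < N" for u
  proof -
    consider "u = 0" | "u = 1" | "2 \<le> u" by linarith
    then show ?thesis
      using that calculation u[of u] assms(3,4) by cases (auto simp: input_store_def)
  qed
  ultimately show ?thesis by (simp add: represents_def)
qed

text \<open>\<open>g\<close> maps a quarter plane to \<open>M\<close>. On a row labelled
  \<open>2 ^ T\<close> the counter has a zero; as \<open>T < 4 * 2 ^ T\<close>, the run started
  there makes \<open>T\<close> steps without restart and halts, and the final clause
  applies.\<close>

lemma system_forces_output:
  fixes x :: "nat \<Rightarrow> 'm::comm_monoid_add \<Rightarrow> 'k::field_char_0"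
  assumes g: "\<And>i j. g (Suc i) j = g i j + e" "\<And>i j. g i (Suc j) = g i j + f"
    and x: "\<forall>C\<in>set (system e f N c0 cs). holds x C"
    and cs: "set cs = residuals c0" "\<And>c. c \<in> set cs \<Longrightarrow> registers_below N c" and N: "3 \<le> N"
    and input: "\<And>l. x 0 l = - of_nat (Suc a)" "\<And>l. x 1 l = - of_nat (Suc b)"
    and run: "(step ^^ T) (c0, input_store a b) = (Skip, s)"
  shows "s 2 = 0"
proof -
  have "\<forall>C\<in>set (row_clauses e f 2 3 4). holds x C" "\<forall>C\<in>set (row_clauses f e 3 2 5). holds x C"
    and init: "\<forall>C\<in>set (init_clauses N c0). holds x C" and final: "holds x final_clause"
    and step: "\<And>c. c \<in> set cs \<Longrightarrow> \<forall>C\<in>set (step_clauses e N c). holds x C"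
    using x unfolding system_def by auto
  then have rows: "\<And>l. x 2 (l + f) = x 2 l \<and> (x 2 l = 1 \<or> x 2 (l + e) = 1) \<and>
     (x 2 l = x 3 l \<longrightarrow> x 4 l = 0 \<or> x 4 l = 2 * x 3 l) \<and>
     (x 4 l = x 3 l \<longrightarrow> x 2 l = 2 * x 3 l) \<and>
     x 4 (l + e) = (if x 4 l + 1 = 4 * x 3 l then 0 else x 4 l + 1)"
   and cols: "\<And>l. x 3 (l + e) = x 3 l \<and> (x 3 l = 1 \<or> x 3 (l + f) = 1) \<and>
     (x 3 l = x 2 l \<longrightarrow> x 5 l = 0 \<or> x 5 l = 2 * x 2 l) \<and>
     (x 5 l = x 2 l \<longrightarrow> x 3 l = 2 * x 2 l) \<and>
     x 5 (l + f) = (if x 5 l + 1 = 4 * x 2 l then 0 else x 5 l + 1)"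
    unfolding holds_row_clauses by blast+
  note R = rows[of "g i j" for i j, folded g] and C = cols[of "g i j" for i j, folded g]
  have "\<exists>i j. x 2 (g i j) = 2 ^ T \<and> x 3 (g i j) = 2 ^ T"
    by (rule labels_unbounded[where V = "\<lambda>i j. x 2 (g i j)" and W = "\<lambda>i j. x 3 (g i j)" and
      d = "\<lambda>i j. x 4 (g i j)" and d' = "\<lambda>i j. x 5 (g i j)"]; use R C in blast)
  then obtain i j where ij: "x 2 (g i j) = of_nat (2 ^ T)" "x 3 (g i j) = of_nat (2 ^ T)" by auto
  have "x 3 (g i' j) = x 3 (g 0 j)" for i' by (induction i') (auto simp: g cols)
  then have row: "x 3 (g i' j) = of_nat (2 ^ T)" for i' using ij(2) by metis
  have count: "x 4 (g (Suc i') j) = (if x 4 (g i' j) + 1 = 4 * of_nat (2 ^ T) then 0 else x 4 (g i' j) + 1)" for i'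
    using rows[of "g i' j"] unfolding g row by blast
  have "x 2 (g i j) = of_nat (2 ^ T) \<Longrightarrow> x 4 (g i j) = 0 \<or> x 4 (g i j) = 2 * of_nat (2 ^ T)"
    using rows[of "g i j"] unfolding row by blast
  then obtain i0 where i0: "x 4 (g i0 j) = 0"
    using counter_zero[of "\<lambda>i. x 4 (g i j)" "2 ^ T" "\<lambda>i. x 2 (g i j)" i, OF count _ ij(1)] by auto
  have time: "x 4 (g (i0 + t) j) = of_nat t" if "t < 4 * 2 ^ T" for t
    using counter_run[of "\<lambda>i. x 4 (g i j)" "2 ^ T" i0 0 t, OF count] i0 that by simp
  have "T < 2 ^ T" by simp
  have "t \<le> T \<Longrightarrow> fst ((step ^^ t) (c0, input_store a b)) \<in> set cs \<and>
      represents N x (g (i0 + t) j) ((step ^^ t) (c0, input_store a b))" for t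
  proof (induction t)
    case 0
    then show ?case using represents_init[OF init i0 input] self_in_residuals cs(1) by simp
  next
    case (Suc t)
    obtain c s where cs': "(step ^^ t) (c0, input_store a b) = (c, s)" by fastforce
    obtain r q c' c'' t' \<alpha> p \<beta> where i: "instr c = (r, q, c', c'', t', \<alpha>, p, \<beta>)" by (cases "instr c") (metis surj_pair)
    from Suc cs' have c: "c \<in> set cs" and rep: "represents N x (g (i0 + t) j) (c, s)" by auto
    have "Suc t < 4 * 2 ^ T" using Suc.prems \<open>T < 2 ^ T\<close> by linarith
    \<comment> \<open>The counter at the next point is \<open>Suc t\<close>, so no restart disables
      the step clauses.\<close>
    from time[OF this] have "x 4 (g (i0 + t) j + e) \<noteq> 0" by (simp add: g del: of_nat_Suc)
    moreover have "x 6 (g (i0 + t) j) = of_nat (to_nat c)" using rep by (simp add: represents_def)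
    ultimately have "represents N x (g (i0 + t) j + e) (step (c, s))"
      using step[OF c] unfolding holds_step_clauses[OF i] represents_step[OF rep cs(2)[OF c] i] by blast
    moreover have "fst (step (c, s)) \<in> set cs" using c cs(1) residuals_step[of "(c, s)"] by simp
    ultimately show ?case using cs' by (simp add: g)
  qed
  from this[of T] have "represents N x (g (i0 + T) j) (Skip, s)" using run by simp
  then have "x 6 (g (i0 + T) j) = of_nat (to_nat Skip)" "x (7 + 2) (g (i0 + T) j) = of_nat (s 2)"
    using spec[of "\<lambda>u. u < N \<longrightarrow> x (7 + u) (g (i0 + T) j) = of_nat (s u)" 2] N
    by (auto simp: represents_def)
  then show ?thesis using final unfolding holds_final_clause by simp
qed

section \<open>A solution on the whole plane\<close>

text \<open>For nonzero \<open>i\<close> this is the reciprocal of the 2-adic absolute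
  value.\<close>

definition two_part :: "int \<Rightarrow> int" where
  "two_part i = (if i = 0 then 0 else 2 ^ multiplicity 2 i)"

lemma two_part_times_odd: "two_part (2 ^ k * (2 * m + 1)) = 2 ^ k"
proof -
  have "2 ^ k * (2 * m + 1) \<noteq> 0" by simp presburger
  moreover have "multiplicity 2 (2 * m + 1) = 0" by (rule not_dvd_imp_multiplicity_0) simp
  then have "multiplicity 2 (2 ^ k * (2 * m + 1)) = k"
    by (subst prime_elem_multiplicity_mult_distrib) (auto, presburger)
  ultimately show ?thesis by (simp add: two_part_def)
qed

lemma two_part_decompose:
  assumes "i \<noteq> 0"
  obtains k m where "two_part i = 2 ^ k" "i = 2 ^ k * (2 * m + 1)"
proof -
  obtain y where y: "i = 2 ^ multiplicity 2 i * y" "\<not> 2 dvd y"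
    using multiplicity_decompose'[of i 2] assms by auto
  then obtain m where "y = 2 * m + 1" by (metis oddE)
  then show thesis using that[of "multiplicity 2 i" m] y(1) assms by (simp add: two_part_def)
qed

lemma two_part_nonneg: "0 \<le> two_part i"
  by (simp add: two_part_def)

lemma two_part_odd: "odd i \<Longrightarrow> two_part i = 1"
  using two_part_times_odd[of 0] by (auto elim!: oddE)

text \<open>Since \<open>mod 0\<close> is the identity, the counter for the label 0 is
  \<open>i\<close> itself and is unbounded in both directions.\<close>

definition counter :: "int \<Rightarrow> int \<Rightarrow> int" where
  "counter L i = (i - L) mod (4 * L)"

text \<open>If \<open>i = L * (2 * m + 1)\<close>, then \<open>i - L = 2 * L * m\<close>, and the
  parity of \<open>m\<close> decides.\<close>

lemma counter_at_label:
  assumes "two_part i = L" shows "counter L i = 0 \<or> counter L i = 2 * L"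
proof (cases "i = 0")
  case False
  then obtain k m where k: "two_part i = 2 ^ k" "i = 2 ^ k * (2 * m + 1)" by (rule two_part_decompose)
  then have "i - L = 2 * L * m" "4 * L = 2 * L * 2" using assms by (auto simp: algebra_simps)
  then have "counter L i = 2 * L * (m mod 2)"
    unfolding counter_def by (simp only: mult_mod_right)
  then show ?thesis by (cases "even m") (auto simp: even_iff_mod_2_eq_zero odd_iff_mod_2_eq_one)
qed (use assms in \<open>simp add: two_part_def counter_def\<close>)

text \<open>The hypothesis gives \<open>i = 2 * L * (2 * q + 1)\<close> with \<open>L\<close> a
  power of 2, or \<open>i = 0\<close> if \<open>L = 0\<close>.\<close>

lemma label_at_counter:
  assumes L: "L = two_part j" and "counter L i = L" shows "two_part i = 2 * L"
proof (cases "j = 0")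
  case False
  then obtain k where k: "L = 2 ^ k" using two_part_decompose L by metis
  have "i - L = 4 * L * ((i - L) div (4 * L)) + L"
    using assms(2) unfolding counter_def by (metis mult_div_mod_eq)
  then have "i = 2 ^ Suc k * (2 * ((i - L) div (4 * L)) + 1)" using k by (simp add: algebra_simps)
  then show ?thesis using two_part_times_odd[of "Suc k"] k by (metis power_Suc)
qed (use assms in \<open>simp add: two_part_def counter_def\<close>)

text \<open>For \<open>L = 0\<close> the two branches agree, as the first is taken only if
  \<open>i + 1 = 0\<close>.\<close>

lemma counter_Suc:
  assumes "0 \<le> L"
  shows "counter L (i + 1) = (if counter L i + 1 = 4 * L then 0 else counter L i + 1)"
proof (cases "L = 0")
  case False
  have "counter L (i + 1) = (counter L i + 1) mod (4 * L)"
    unfolding counter_def by (simp add: mod_simps algebra_simps)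
  moreover have "0 \<le> counter L i" "counter L i < 4 * L" using assms False by (auto simp: counter_def)
  ultimately show ?thesis by auto
qed (auto simp: counter_def)

text \<open>Rows with the label \<open>0\<close> idle before the counter reaches \<open>0\<close>.\<close>

definition state_at :: "com \<times> (nat \<Rightarrow> nat) \<Rightarrow> int \<Rightarrow> com \<times> (nat \<Rightarrow> nat)" where
  "state_at cs t = (if 0 \<le> t then (step ^^ nat t) cs else (Skip, \<lambda>_. 0))"

text \<open>At the excluded \<open>t = -1\<close> the idle phase gives way to the run.\<close>

lemma state_at_Suc:
  assumes "t + 1 \<noteq> 0" shows "state_at cs (t + 1) = step (state_at cs t)"
proof (cases "0 \<le> t")
  case True
  then have "nat (t + 1) = Suc (nat t)" by simp
  then show ?thesis using True by (simp add: state_at_def del: step.simps)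
next
  case False
  then show ?thesis using assms by (simp add: state_at_def step_Skip del: step.simps)
qed

text \<open>\<open>h1\<close> and \<open>h2\<close> are integer coordinates on \<open>M\<close>.
  Labels and counters are explicit functions of them, and a point with counter \<open>d l\<close>
  carries the state of the run at time \<open>d l\<close>.\<close>

lemma system_solvable:
  fixes h1 h2 :: "'m::comm_monoid_add \<Rightarrow> int"
  assumes h: "\<And>l. h1 (l + e) = h1 l + 1" "\<And>l. h2 (l + e) = h2 l"
      "\<And>l. h1 (l + f) = h1 l" "\<And>l. h2 (l + f) = h2 l + 1"
    and cs: "set cs = residuals c0" "\<And>c. c \<in> set cs \<Longrightarrow> registers_below N c" and N: "3 \<le> N"
    and run: "(step ^^ T) (c0, input_store a b) = (Skip, s)" "s 2 = 0"
  shows "\<exists>x :: nat \<Rightarrow> 'm \<Rightarrow> 'k::field_char_0. (\<forall>C\<in>set (system e f N c0 cs). holds x C) \<and>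
    (\<forall>l. x 0 l = - of_nat (Suc a)) \<and> (\<forall>l. x 1 l = - of_nat (Suc b))"
proof -
  define d where "d l = counter (two_part (h2 l)) (h1 l)" for l
  define S where "S l = state_at (c0, input_store a b) (d l)" for l
  define x :: "nat \<Rightarrow> 'm \<Rightarrow> 'k" where
    "x = (\<lambda>i l. if i = 0 then - of_nat (Suc a) else if i = 1 then - of_nat (Suc b)
      else if i = 2 then of_int (two_part (h1 l)) else if i = 3 then of_int (two_part (h2 l))
      else if i = 4 then of_int (d l) else if i = 5 then of_int (counter (two_part (h1 l)) (h2 l))
      else if i = 6 then of_nat (to_nat (fst (S l))) else of_nat (snd (S l) (i - 7)))"
  have x: "x 0 l = - of_nat (Suc a)" "x 1 l = - of_nat (Suc b)" "x 2 l = of_int (two_part (h1 l))"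
    "x 3 l = of_int (two_part (h2 l))" "x 4 l = of_int (d l)" "x 5 l = of_int (counter (two_part (h1 l)) (h2 l))"
    "x 6 l = of_nat (to_nat (fst (S l)))" "x (7 + u) l = of_nat (snd (S l) u)" for l u
    by (simp_all add: x_def del: of_nat_Suc)
  have rep: "represents N x l (S l)" for l by (simp only: represents_def x) simp
  have of_int1: "(of_int z + 1 = 4 * (of_int w :: 'k)) \<longleftrightarrow> z + 1 = 4 * w" for z w
    using of_int_eq_iff[of "z + 1" "4 * w", where 'a = 'k] by simp
  have of_int2: "(of_int z = 2 * (of_int w :: 'k)) \<longleftrightarrow> z = 2 * w" for z w
    using of_int_eq_iff[of z "2 * w", where 'a = 'k] by simp
  have odd: "two_part i = 1 \<or> two_part (i + 1) = 1" for i
    using two_part_odd[of i] two_part_odd[of "i + 1"] by auto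
  have "\<forall>C\<in>set (row_clauses e f 2 3 4). holds x C"
    unfolding holds_row_clauses
  proof (intro allI)
    fix l
    show "x 2 (l + f) = x 2 l \<and> (x 2 l = 1 \<or> x 2 (l + e) = 1) \<and>
       (x 2 l = x 3 l \<longrightarrow> x 4 l = 0 \<or> x 4 l = 2 * x 3 l) \<and> (x 4 l = x 3 l \<longrightarrow> x 2 l = 2 * x 3 l) \<and>
       x 4 (l + e) = (if x 4 l + 1 = 4 * x 3 l then 0 else x 4 l + 1)"
      using odd[of "h1 l"] counter_at_label[of "h1 l" "two_part (h2 l)"]
        label_at_counter[OF refl, of "h2 l" "h1 l"] counter_Suc[OF two_part_nonneg, of "h2 l" "h1 l"]
      unfolding x d_def h of_int1 of_int2 by simp
  qed
  moreover have "\<forall>C\<in>set (row_clauses f e 3 2 5). holds x C"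
    unfolding holds_row_clauses
  proof (intro allI)
    fix l
    show "x 3 (l + e) = x 3 l \<and> (x 3 l = 1 \<or> x 3 (l + f) = 1) \<and>
       (x 3 l = x 2 l \<longrightarrow> x 5 l = 0 \<or> x 5 l = 2 * x 2 l) \<and> (x 5 l = x 2 l \<longrightarrow> x 3 l = 2 * x 2 l) \<and>
       x 5 (l + f) = (if x 5 l + 1 = 4 * x 2 l then 0 else x 5 l + 1)"
      using odd[of "h2 l"] counter_at_label[of "h2 l" "two_part (h1 l)"]
        label_at_counter[OF refl, of "h1 l" "h2 l"] counter_Suc[OF two_part_nonneg, of "h1 l" "h2 l"]
      unfolding x h of_int1 of_int2 by simp
  qed
  moreover have "\<forall>C\<in>set (init_clauses N c0). holds x C"
    unfolding holds_init_clauses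
  proof (intro allI impI)
    fix l assume "x 4 l = 0"
    then have S: "S l = (c0, input_store a b)" by (simp add: x S_def state_at_def)
    then show "x 6 l = of_nat (to_nat c0) \<and> x 7 l + (x 0 l + 1) = 0 \<and>
       x 8 l + (x 1 l + 1) = 0 \<and> (\<forall>u\<in>{2..<N}. x (7 + u) l = 0)"
      using x(8)[of 0 l] x(8)[of 1 l] x(2)[of l] by (auto simp: x input_store_def)
  qed
  moreover have "holds x final_clause"
    unfolding holds_final_clause
  proof (intro allI impI)
    fix l assume "x 6 l = of_nat (to_nat Skip)"
    then have "fst (S l) = Skip" by (simp add: x)
    then obtain s' where s': "S l = (Skip, s')" by (cases "S l") auto
    \<comment> \<open>A halted point carries the unique final store of the run or, while idling, the
      zero store.\<close>
    have "s' 2 = 0"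
    proof (cases "0 \<le> d l")
      case True
      then show ?thesis
        using s' steps_Skip_unique[OF run(1)] run(2) by (auto simp: S_def state_at_def)
    qed (use s' in \<open>auto simp: S_def state_at_def\<close>)
    then show "x 9 l = 0" using x(8)[of 2 l] s' by simp
  qed
  moreover have "\<forall>C\<in>set (step_clauses e N c). holds x C" if c: "c \<in> set cs" for c
  proof -
    obtain r q c' c'' t \<alpha> p \<beta> where i: "instr c = (r, q, c', c'', t, \<alpha>, p, \<beta>)" by (cases "instr c") (metis surj_pair)
    show ?thesis
      unfolding holds_step_clauses[OF i]
    proof (intro allI impI)
      fix l assume l: "x 6 l = of_nat (to_nat c)" "x 4 (l + e) \<noteq> 0"
      then have "fst (S l) = c" by (simp add: x)
      then have S: "S l = (c, snd (S l))" by auto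
      \<comment> \<open>A nonzero counter at the next point excludes a wrap.\<close>
      have "d (l + e) = d l + 1"
        using l(2) counter_Suc[OF two_part_nonneg, of "h2 l" "h1 l"] by (auto simp: x d_def h split: if_splits)
      then have "S (l + e) = step (S l)"
        unfolding S_def using l(2) x(5)[of "l + e"] state_at_Suc[of "d l"] by (metis of_int_0)
      then have "represents N x (l + e) (step (c, snd (S l)))"
        using rep[of "l + e"] S by metis
      then show "x 6 (l + e) = (if x (7 + r) l = x (7 + q) l then of_nat (to_nat c') else of_nat (to_nat c'')) \<and>
          (\<forall>u<N. x (7 + u) (l + e) = (if u = t then of_nat \<alpha> * x (7 + p) l + of_nat \<beta> else x (7 + u) l))"
        using represents_step[OF _ cs(2)[OF c] i, of x l "snd (S l)" "l + e"] rep[of l] S by metis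
    qed
  qed
  ultimately have "\<forall>C\<in>set (system e f N c0 cs). holds x C"
    unfolding system_def by auto
  then show ?thesis using x(1,2) by blast
qed

section \<open>Diagonalisation\<close>

text \<open>Iterated addition of 1. The addition program is specified only on codes of elements of
  \<open>K0\<close>, so the recursion is set up with programs and not with
  \<open>recursive_rec\<close>.\<close>

lemma recursive_code_of_nat:
  fixes K0 :: "'k::field set"
  assumes "computable_subfield K0 c"
  shows "recursive 1 (\<lambda>xs. c (of_nat (xs ! 0)))"
proof -
  have K0: "is_subfield K0" using assms by (simp add: computable_subfield_def)
  obtain p where p: "\<And>a b. a \<in> K0 \<Longrightarrow> b \<in> K0 \<Longrightarrow> computes p [c a, c b] (c (a + b))"
    using assms unfolding computable_subfield_def by blast
  obtain q where q: "\<And>xs. length xs = 0 \<Longrightarrow> computes q xs (c 0)"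
    using recursive_const[of 0 "c 0"] unfolding recursive_def by blast
  obtain r where r: "\<And>xs. length xs = 2 \<Longrightarrow> computes r xs (c 1)"
    using recursive_const[of 2 "c 1"] unfolding recursive_def by blast
  let ?p = "Prec q (Comp p [r, Proj 1])"
  have "computes ?p [n] (c (of_nat n))" for n
  proof (induction n)
    case 0
    then show ?case by (auto intro: computes.Prec_0 q)
  next
    case (Suc n)
    let ?xs = "[n, c (of_nat n)]"
    have "computes (Comp p [r, Proj 1]) ?xs (c (1 + of_nat n))"
    proof (rule computes.Comp[where ys = "[c 1, c (of_nat n)]"])
      show "computes ([r, Proj 1] ! i) ?xs ([c 1, c (of_nat n)] ! i)" if "i < length [r, Proj 1]" for i
        using that r[of ?xs] computes.Proj[of 1 ?xs] by (auto simp: less_Suc_eq)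
      show "computes p [c 1, c (of_nat n)] (c (1 + of_nat n))"
        using of_nat_in_subfield[OF K0, of 1] of_nat_in_subfield[OF K0, of n] by (intro p) auto
    qed simp
    with Suc show ?case by (auto intro: computes.Prec_Suc)
  qed
  then show ?thesis
    unfolding recursive_def by (intro exI[of _ ?p]) (auto simp: length_Suc_conv)
qed

lemma set_encode_insert: "finite A \<Longrightarrow> a \<notin> A \<Longrightarrow> set_encode (insert a A) = set_encode A + 2 ^ a"
  by (simp add: set_encode_def)

text \<open>The map \<open>g\<close> serves to read a run off a solution, the coordinates
  \<open>h1\<close> and \<open>h2\<close> to build one; this covers both monoids at once.\<close>

lemma not_solvability_decidable:
  fixes K0 :: "'k::field_char_0 set" and em :: "'m::comm_monoid_add \<Rightarrow> nat"
  assumes comp: "computable_subfield K0 c" and em: "inj em"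
    and g: "\<And>i j. (g :: nat \<Rightarrow> nat \<Rightarrow> 'm) (Suc i) j = g i j + e" "\<And>i j. g i (Suc j) = g i j + f"
    and h: "\<And>l. (h1 :: 'm \<Rightarrow> int) (l + e) = h1 l + 1" "\<And>l. (h2 :: 'm \<Rightarrow> int) (l + e) = h2 l"
      "\<And>l. h1 (l + f) = h1 l" "\<And>l. h2 (l + f) = h2 l + 1"
  shows "\<not> solvability_decidable em K0 c"
proof
  assume "solvability_decidable em K0 c"
  then obtain D where D: "\<And>n F. finite F \<Longrightarrow> F \<subseteq> M_polys K0 n \<Longrightarrow>
      computes D [encode_system em c n F] (if \<exists>x. is_solution K0 n F x then 1 else 0)"
    unfolding solvability_decidable_def by blast
  have K0: "is_subfield K0" and inj: "inj_on c K0" using comp by (auto simp: computable_subfield_def)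
  define E where "E i a = encode_mpoly em c (input_poly i a :: ('m, 'k) mpoly)" for i a
  have E: "recursive 2 (\<lambda>xs. E i (xs ! j))" if j: "j < 2" for i j
  proof -
    obtain \<kappa> where \<kappa>: "\<And>a. E i a = 2 ^ prod_encode (\<kappa>, c 1) + 2 ^ prod_encode (0, c (of_nat (Suc a)))"
      using encode_input_poly[OF em, of c i] unfolding E_def by blast
    have "recursive 2 (\<lambda>xs. c (of_nat (Suc (xs ! j))))"
      by (rule recursive_compose1[OF recursive_code_of_nat[OF comp]]) (intro recursive_Suc recursive_nth j)
    then show ?thesis
      unfolding \<kappa> by (intro recursive_add recursive_power2 recursive_prod_encode recursive_const)
  qed
  have "recursive 2 (\<lambda>xs. prod_encode (xs ! 0, (xs ! 1 + 2 ^ E 1 (xs ! 1)) + 2 ^ E 0 (xs ! 0)))"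
    by (intro recursive_prod_encode recursive_add recursive_power2 recursive_nth E) simp_all
  \<comment> \<open>Adding an input polynomial to a coded set adds the power of 2 whose exponent is
    its code.\<close>
  then obtain P where P: "\<And>a b. computes P [a, b] (prod_encode (a, (b + 2 ^ E 1 b) + 2 ^ E 0 a))"
    unfolding recursive_def by (metis (no_types, lifting) length_Cons list.size(3) nth_Cons_0 nth_Cons_Suc numeral_2_eq_2 One_nat_def)
  obtain c0 where c0: "\<And>s y. computes (Comp D [P]) [s 0, s 1] y \<Longrightarrow>
      \<exists>n s'. (step ^^ n) (c0, s) = (Skip, s') \<and> s' 2 = y"
    using compile_program by blast
  obtain cs where cs: "set cs = residuals c0" using finite_list[OF finite_residuals] by blast
  have "\<exists>N. registers_below N c" for c
    by (rule exI[of _ "Suc (case instr c of (r, q, c', c'', t, a, p, b) \<Rightarrow> r + q + p)"])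
      (auto simp: registers_below_def split: prod.splits)
  then obtain B where B: "\<And>c. registers_below (B c) c" by metis
  define N where "N = 3 + sum_list (map B cs)"
  have N: "registers_below N c" if "c \<in> set cs" for c
  proof -
    have "B c \<le> N" using member_le_sum_list[of "B c" "map B cs"] that by (simp add: N_def)
    then show ?thesis using B[of c] by (auto simp: registers_below_def split: prod.splits)
  qed
  have N3: "3 \<le> N" by (simp add: N_def)
  define cls :: "('m, 'k) clause list" where "cls = system e f N c0 cs"
  have cls: "{p, q, r} \<subseteq> M_polys K0 (7 + N)" if "(p, q, r) \<in> set cls" for p q r
    using system_in_M_polys[OF K0 N3 N] that unfolding cls_def by blast
  define F where "F = (\<lambda>j. clause_poly (7 + N + 2 * j) (cls ! j)) ` {..<length cls}"
  define n where "n = 7 + N + 2 * length cls"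
  define b where "b = set_encode (encode_mpoly em c ` F)"
  \<comment> \<open>The program \<open>c0\<close> was fixed before \<open>n\<close> and
    \<open>b\<close>, so the system can receive its own size and code as inputs.\<close>
  define F' where "F' = insert (input_poly 0 n) (insert (input_poly 1 b) F)"
  have input: "(input_poly i a :: ('m, 'k) mpoly) \<in> M_polys K0 n" if "i < 2" for i a
    unfolding input_poly_def using that
    by (intro M_polys_add indet_in_M_polys const_of_nat_in_M_polys K0) (simp add: n_def)
  have FM: "F \<subseteq> M_polys K0 n"
  proof
    fix p assume "p \<in> F"
    then obtain j where j: "j < length cls" "p = clause_poly (7 + N + 2 * j) (cls ! j)" by (auto simp: F_def)
    obtain p' q' r' where "cls ! j = (p', q', r')" by (cases "cls ! j")
    with j show "p \<in> M_polys K0 n"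
      using cls[of p' q' r'] nth_mem[OF j(1)]
      by (auto simp: n_def intro!: clause_poly_in_M_polys[where N = "7 + N"] K0)
  qed
  then have F': "finite F'" "F' \<subseteq> M_polys K0 n"
    using input by (auto simp: F'_def F_def)
  have zero: "eval_mpoly (\<lambda>_ _. 0) p l = 0" if "p \<in> F" for p l
    using that by (auto simp: F_def eval_mpoly_clause_poly_zero)
  have eval_input: "eval_mpoly x (input_poly i a) l = x i l + of_nat (Suc a)" for x :: "nat \<Rightarrow> 'm \<Rightarrow> 'k" and i a l
    by (simp add: input_poly_def eval_mpoly_add)
  \<comment> \<open>The code grows by exactly the two powers of 2 only if both input polynomials are
    new and distinct.\<close>
  have "input_poly 1 b \<notin> F" "input_poly 0 n \<notin> F"
    using zero eval_input[of "\<lambda>_ _. 0"] of_nat_neq_0 by fastforce+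
  moreover have "input_poly 0 n \<noteq> (input_poly 1 b :: ('m, 'k) mpoly)"
  proof
    assume eq: "input_poly 0 n = (input_poly 1 b :: ('m, 'k) mpoly)"
    \<comment> \<open>Evaluation at the constant sequences \<open>i\<close> gives
      \<open>n = b + 1\<close>, at the zero sequences \<open>n = b\<close>.\<close>
    show False
      using eval_input[of "\<lambda>i _. of_nat i" 0 n 0] eval_input[of "\<lambda>i _. of_nat i" 1 b 0]
        eval_input[of "\<lambda>_ _. 0" 0 n 0] eval_input[of "\<lambda>_ _. 0" 1 b 0] unfolding eq by simp
  qed
  ultimately have notin: "E 1 b \<notin> encode_mpoly em c ` F" "E 0 n \<notin> insert (E 1 b) (encode_mpoly em c ` F)"
    using inj_on_encode_mpoly[OF em inj, of n] FM input[of 0 n] input[of 1 b]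
    unfolding E_def by (auto dest!: inj_onD)
  have code: "encode_system em c n F' = prod_encode (n, (b + 2 ^ E 1 b) + 2 ^ E 0 n)"
    using notin unfolding encode_system_def F'_def b_def E_def image_insert
    by (subst set_encode_insert, simp add: F_def, simp, subst set_encode_insert) (simp_all add: F_def)
  define v :: nat where "v = (if \<exists>x. is_solution K0 n F' x then 1 else 0)"
  have "computes (Comp D [P]) [n, b] v"
    using P[of n b] D[OF F'] unfolding v_def code
    by (intro computes.Comp[where ys = "[prod_encode (n, (b + 2 ^ E 1 b) + 2 ^ E 0 n)]"]) auto
  then obtain T s where run: "(step ^^ T) (c0, input_store n b) = (Skip, s)" "s 2 = v"
    using c0[of "input_store n b" v] unfolding input_store_def by auto
  have sol: "is_solution K0 n F' x \<longleftrightarrow> (\<forall>l. x 0 l = - of_nat (Suc n)) \<and> (\<forall>l. x 1 l = - of_nat (Suc b)) \<and>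
      (\<forall>j<length cls. eval_mpoly x (clause_poly (7 + N + 2 * j) (cls ! j)) = 0)" for x
    unfolding is_solution_iff[OF K0 F'(2)]
    by (auto simp: F'_def F_def fun_eq_iff eval_input eq_neg_iff_add_eq_0 simp del: of_nat_Suc)
  have nonzero: "- of_nat (Suc n) \<noteq> (0 :: 'k)" using of_nat_neq_0[of n] by (simp del: of_nat_Suc)
  show False
  \<comment> \<open>If solvable, the system forces the output 0 although \<open>D\<close> answers 1;
    if not, \<open>D\<close> answers 0 and a solution can be built.\<close>
  proof (cases "\<exists>x. is_solution K0 n F' x")
    case True
    then obtain x where x: "is_solution K0 n F' x" by blast
    have "\<forall>C\<in>set cls. holds x C"
      using x nonzero unfolding sol by (subst solvable_clause_polys[OF K0 _ cls]) auto
    then have "s 2 = 0"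
      by (intro system_forces_output[where g = g and x = x, OF g _ cs N N3 _ _ run(1)])
        (use x in \<open>auto simp: cls_def sol simp del: of_nat_Suc\<close>)
    then show False using run(2) True by (simp add: v_def)
  next
    case False
    then have "s 2 = 0" using run(2) by (simp add: v_def)
    then obtain x :: "nat \<Rightarrow> 'm \<Rightarrow> 'k" where x: "\<forall>C\<in>set cls. holds x C"
      "\<And>l. x 0 l = - of_nat (Suc n)" "\<And>l. x 1 l = - of_nat (Suc b)"
      using system_solvable[of h1 e h2 f, OF h cs N N3 run(1)] unfolding cls_def by blast
    then obtain y where "\<forall>i<7 + N. y i = x i"
      "\<forall>j<length cls. eval_mpoly y (clause_poly (7 + N + 2 * j) (cls ! j)) = 0"
      using solvable_clause_polys[OF K0 _ cls, where x = x] nonzero by auto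
    then have "is_solution K0 n F' y" using x(2,3) unfolding sol by auto
    then show False using False by blast
  qed
qed

theorem proposition3p9:
  fixes K0 :: "'k::field_char_0 set" and c :: "'k \<Rightarrow> nat"
  assumes "computable_subfield K0 c"
  shows "\<not> solvability_decidable encode_N2 K0 c \<and> \<not> solvability_decidable encode_Z2 K0 c"
proof
  show "\<not> solvability_decidable encode_N2 K0 c"
    by (rule not_solvability_decidable[where g = Pair and e = "(1, 0)" and f = "(0, 1)" and
        ?h1.0 = "\<lambda>l. int (fst l)" and ?h2.0 = "\<lambda>l. int (snd l)", OF assms])
      (simp_all add: encode_N2_def inj_prod_encode)
  have "inj encode_Z2"
    by (rule injI) (auto simp: encode_Z2_def inj_eq[OF inj_int_encode] split: prod.splits)
  then show "\<not> solvability_decidable encode_Z2 K0 c"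
    by (rule not_solvability_decidable[where g = "\<lambda>i j. (int i, int j)" and e = "(1, 0)" and f = "(0, 1)" and
        ?h1.0 = fst and ?h2.0 = snd, OF assms]) simp_all
qed

end
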